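(* Let $\varepsilon>0$ and $0\le\varepsilon_g<\varepsilon$. Write $\mathrm{BR}=\mathcal{M}_{\mathrm{BR}}(\varepsilon)$ and $\mathrm{DP}=\mathcal{M}_{\mathrm{DP}}(\varepsilon)$. Then $$\delta_{\mathrm{opt}}(\mathrm{DP},\mathrm{BR},\mathrm{BR};\varepsilon_g)>\delta_{\mathrm{opt}}(\mathrm{BR},\mathrm{DP},\mathrm{BR};\varepsilon_g).$$ Furthermore, with $$x(t)=q_{2\varepsilon,\varepsilon}\left(q_{\varepsilon,t}\,q_{\varepsilon,\frac{\varepsilon_g-t}{2}}^2(1-e^{-\varepsilon})+(1-q_{\varepsilon,t})\,q_{\varepsilon,\frac{\varepsilon_g+\varepsilon-t}{2}}^2(1-e^{-\varepsilon})\right),$$ $$y(t)=q_{2\varepsilon,\varepsilon}\left(q_{\varepsilon,t}(1-e^{\varepsilon_g-\varepsilon-t})+(1-q_{\varepsilon,t})\,q_{\varepsilon,\frac{\varepsilon_g+\varepsilon-t}{2}}^2(1-e^{-\varepsilon})\right),$$ $$z(t)=(1-q_{2\varepsilon,\varepsilon})\,q_{\varepsilon,t}\,q_{\varepsilon,\varepsilon+\frac{\varepsilon_g-t}{2}}^2(1-e^{-\varepsilon}),$$ we have $$\delta_{\mathrm{opt}}(\mathrm{DP},\mathrm{BR},\mathrm{BR};\varepsilon_g)=\begin{cases}x(\varepsilon/2)+z\left(\frac{2\varepsilon+\varepsilon_g}{3}\right)&\text{if }\varepsilon_g\ge\varepsilon/2,\\[2pt] y\left(\frac{\varepsilon+\varepsilon_g}{3}\right)+z\left(\frac{2\varepsilon+\varepsilon_g}{3}\right)&\text{otherwise,}\end{cases}$$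 $$\delta_{\mathrm{opt}}(\mathrm{BR},\mathrm{DP},\mathrm{BR};\varepsilon_g)=\begin{cases}\max\{x(\varepsilon/2),\ y(\varepsilon_g)+z(\varepsilon_g)\}&\text{if }\varepsilon_g\ge\varepsilon/2,\\[2pt] \max\{x(\varepsilon_g),\ y(\varepsilon/2)+z(\varepsilon/2)\}&\text{otherwise.}\end{cases}$$
   Context: Notation: $q_{\varepsilon,t}=\frac{1-e^{t-\varepsilon}}{1-e^{-\varepsilon}}$, so $q_{2\varepsilon,\varepsilon}=\frac{1-e^{-\varepsilon}}{1-e^{-2\varepsilon}}$. Mechanisms are randomized maps $M:\mathcal{X}\to\mathcal{Y}$, where $\mathcal{X}$ carries a symmetric neighboring relation (with at least one pair of distinct neighbors) and $\mathcal{Y}$ is an arbitrary outcome set. $M$ is $(\varepsilon,\delta)$-DP if $\Pr[M(x)\in S]\le e^{\varepsilon}\Pr[M(x')\in S]+\delta$ for all neighbors $x,x'$ and $S\subseteq\mathcal{Y}$; $\varepsilon$-DP means $(\varepsilon,0)$-DP. $M$ is $\varepsilon$-bounded range ($\varepsilon$-BR) if for all neighbors $x,x'$ and outcomes $y_1,y_2$, $\frac{\Pr[M(x)=y_1]}{\Pr[M(x')=y_1]}\le e^{\varepsilon}\frac{\Pr[M(x)=y_2]}{\Pr[M(x')=y_2]}$ (masses or densities). $\mathcal{M}_{\mathrm{DP}}(\varepsilon)$ and $\mathcal{M}_{\mathrm{BR}}(\varepsilon)$ are the classes of all $\varepsilon$-DP and all $\varepsilon$-BR mechanisms. For classes $\mathcal{M}_1,\dots,\mathcal{M}_k$,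 the adaptive composition $(\mathcal{M}_1,\dots,\mathcal{M}_k)$ is the class of all mechanisms that on input $x$ output $(y_1,\dots,y_k)$, where $y_1\sim M_1(x)$ with $M_1\in\mathcal{M}_1$ and $y_i\sim M_i(x,y_1,\dots,y_{i-1})$ with fresh randomness, where for every fixed $y_1,\dots,y_{i-1}$ the mechanism $M_i(\cdot,y_1,\dots,y_{i-1})$ belongs to $\mathcal{M}_i$. For $\varepsilon_g\in\mathbb{R}$, $\delta_{\mathrm{opt}}(M;\varepsilon_g)=\inf\{\delta\ge0: M\text{ is }(\varepsilon_g,\delta)\text{-DP}\}$, and for a class $\mathcal{M}$, $\delta_{\mathrm{opt}}(\mathcal{M};\varepsilon_g)=\sup_{M\in\mathcal{M}}\delta_{\mathrm{opt}}(M;\varepsilon_g)$. *)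

theory Defs
  imports "HOL-Probability.Probability"
begin

text \<open>
  A mechanism with inputs in \<open>'x\<close> is given by its outcome space \<open>N\<close>, an arbitrary measurable space
  whose points are elements of \<open>'y\<close>, together with the output distribution \<open>M x\<close> on \<open>N\<close> for each
  input \<open>x\<close>. Discrete mechanisms are those whose distributions are concentrated on countable sets.
\<close>

type_synonym ('x, 'y) mechanism = "'y measure \<times> ('x \<Rightarrow> 'y measure)"

definition is_mechanism :: "('x, 'y) mechanism \<Rightarrow> bool" where
  "is_mechanism = (\<lambda>(N, M). \<forall>x. M x \<in> space (prob_algebra N))"

definition is_DP :: "('x \<Rightarrow> 'x \<Rightarrow> bool) \<Rightarrow> real \<Rightarrow> real \<Rightarrow> ('x, 'y) mechanism \<Rightarrow> bool" where
  "is_DP nb \<epsilon> \<delta> = (\<lambda>(N, M). \<forall>x x'. nb x x' \<longrightarrow>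
     (\<forall>S\<in>sets N. measure (M x) S \<le> exp \<epsilon> * measure (M x') S + \<delta>))"

text \<open>
  Bounded range is expressed through densities \<open>f\<close>, \<open>f'\<close> of \<open>M x\<close>, \<open>M x'\<close> with respect to a common
  base measure \<open>\<mu>\<close>; a counting measure gives the condition on probability masses. The ratio condition
  \<open>f y1 / f' y1 \<le> exp \<epsilon> * (f y2 / f' y2)\<close> is multiplied out, so that outcomes of density \<open>0\<close> under both
  inputs impose nothing. An outcome of density \<open>0\<close> under only one of the two inputs (ratio \<open>0\<close> or
  \<open>\<infinity>\<close>) violates the condition, as it should: it would make one of \<open>f\<close>, \<open>f'\<close> vanish identically.
\<close>

definition is_BR :: "('x \<Rightarrow> 'x \<Rightarrow> bool) \<Rightarrow> real \<Rightarrow> ('x, 'y) mechanism \<Rightarrow> bool" where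
  "is_BR nb \<epsilon> = (\<lambda>(N, M). \<forall>x x'. nb x x' \<longrightarrow>
     (\<exists>\<mu> f f'. f \<in> borel_measurable \<mu> \<and> f' \<in> borel_measurable \<mu> \<and>
        (\<forall>y\<in>space \<mu>. 0 \<le> f y \<and> 0 \<le> f' y) \<and>
        M x = density \<mu> (\<lambda>y. ennreal (f y)) \<and> M x' = density \<mu> (\<lambda>y. ennreal (f' y)) \<and>
        (\<forall>y1\<in>space \<mu>. \<forall>y2\<in>space \<mu>. f y1 * f' y2 \<le> exp \<epsilon> * (f y2 * f' y1))))"

definition DP_class :: "('x \<Rightarrow> 'x \<Rightarrow> bool) \<Rightarrow> real \<Rightarrow> ('x, 'y) mechanism set" where
  "DP_class nb \<epsilon> = {m. is_mechanism m \<and> is_DP nb \<epsilon> 0 m}"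

definition BR_class :: "('x \<Rightarrow> 'x \<Rightarrow> bool) \<Rightarrow> real \<Rightarrow> ('x, 'y) mechanism set" where
  "BR_class nb \<epsilon> = {m. is_mechanism m \<and> is_BR nb \<epsilon> m}"

text \<open>
  Adaptive composition of two classes. Longer compositions are nested to the left: in
  \<open>(C1 \<triangleright> C2) \<triangleright> C3\<close> the third mechanism sees the input and the pair \<open>(y1, y2)\<close> of earlier outcomes, and
  belongs to \<open>C3\<close> for every fixed such pair, so this is the composition of three classes with
  the output triple written as \<open>((y1, y2), y3)\<close>.
\<close>

definition adaptive_comp ::
  "('x, 'y) mechanism set \<Rightarrow> ('x, 'z) mechanism set \<Rightarrow> ('x, 'y \<times> 'z) mechanism set"
  (infixl "\<triangleright>" 65) where
  "C1 \<triangleright> C2 =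
     {(N1 \<Otimes>\<^sub>M N2,
       \<lambda>x. M1 x \<bind> (\<lambda>y1. M2 x y1 \<bind> (\<lambda>y2. return (N1 \<Otimes>\<^sub>M N2) (y1, y2)))) | N1 N2 M1 M2.
        (N1, M1) \<in> C1 \<and>
        (\<forall>x. M2 x \<in> N1 \<rightarrow>\<^sub>M prob_algebra N2) \<and>
        (\<forall>y1\<in>space N1. (N2, \<lambda>x. M2 x y1) \<in> C2)}"

definition delta_opt :: "('x \<Rightarrow> 'x \<Rightarrow> bool) \<Rightarrow> ('x, 'y) mechanism \<Rightarrow> real \<Rightarrow> real" where
  "delta_opt nb m \<epsilon>g = Inf {\<delta>. 0 \<le> \<delta> \<and> is_DP nb \<epsilon>g \<delta> m}"

definition delta_opt_class :: "('x \<Rightarrow> 'x \<Rightarrow> bool) \<Rightarrow> ('x, 'y) mechanism set \<Rightarrow> real \<Rightarrow> real" where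
  "delta_opt_class nb C \<epsilon>g = (SUP m\<in>C. delta_opt nb m \<epsilon>g)"

definition q :: "real \<Rightarrow> real \<Rightarrow> real" where
  "q \<epsilon> t = (1 - exp (t - \<epsilon>)) / (1 - exp (- \<epsilon>))"

definition x_fun :: "real \<Rightarrow> real \<Rightarrow> real \<Rightarrow> real" where
  "x_fun \<epsilon> \<epsilon>g t = q (2 * \<epsilon>) \<epsilon> *
     (q \<epsilon> t * (q \<epsilon> ((\<epsilon>g - t) / 2))\<^sup>2 * (1 - exp (- \<epsilon>))
      + (1 - q \<epsilon> t) * (q \<epsilon> ((\<epsilon>g + \<epsilon> - t) / 2))\<^sup>2 * (1 - exp (- \<epsilon>)))"

definition y_fun :: "real \<Rightarrow> real \<Rightarrow> real \<Rightarrow> real" where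
  "y_fun \<epsilon> \<epsilon>g t = q (2 * \<epsilon>) \<epsilon> *
     (q \<epsilon> t * (1 - exp (\<epsilon>g - \<epsilon> - t))
      + (1 - q \<epsilon> t) * (q \<epsilon> ((\<epsilon>g + \<epsilon> - t) / 2))\<^sup>2 * (1 - exp (- \<epsilon>)))"

definition z_fun :: "real \<Rightarrow> real \<Rightarrow> real \<Rightarrow> real" where
  "z_fun \<epsilon> \<epsilon>g t =
     (1 - q (2 * \<epsilon>) \<epsilon>) * q \<epsilon> t * (q \<epsilon> (\<epsilon> + (\<epsilon>g - t) / 2))\<^sup>2 * (1 - exp (- \<epsilon>))"

text \<open>
  HOL cannot quantify over all types inside the supremum over a class. Statements about these
  classes are instead polymorphic in the type of outcomes, which must have at least two elements:
  over a one-element type every mechanism is constant.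
\<close>

definition two_elements :: "'y itself \<Rightarrow> bool" where
  "two_elements _ \<longleftrightarrow> (\<exists>a b :: 'y. a \<noteq> b)"

end

theory Submission
  imports Defs
begin

text \<open>
  The pairs of output distributions of a bounded-range mechanism on two neighbors are exactly those whose
  log-likelihood ratio lies in an interval \<open>[t - \<epsilon>, t]\<close>, and for a pure DP mechanism the interval is
  \<open>[- \<epsilon>, \<epsilon>]\<close>. With the ratio confined to \<open>[- b, a]\<close>, the pair is a post-processing of the two-point
  pair with ratios \<open>a\<close> and \<open>- b\<close>, so the optimal \<open>\<delta>\<close> of a composition is the value of a game in which
  each bounded-range step chooses its \<open>t\<close> knowing the ratios accumulated so far. The last step has a closed
  value by the AM-GM inequality. If the DP step comes first, the next step may choose separate \<open>t\<close> for the
  two outcomes and the value is \<open>max y + max z\<close> (with \<open>x\<close> in place of \<open>y\<close> for \<open>t \<le> \<epsilon>g\<close>); if it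
  comes second, one \<open>t\<close> must serve both outcomes. As \<open>x = y + z\<close> identically, the latter value is
  \<open>max x = x (\<epsilon> / 2)\<close>, which is strictly smaller because the maximizers differ.
\<close>

subsection \<open>Adaptive composition of kernels\<close>

text \<open>The inner expression of \<open>adaptive_comp\<close> at one fixed input: the joint law
  of \<open>y1\<close> drawn from \<open>P\<close> and \<open>y2\<close> drawn from
  \<open>K y1\<close>.\<close>

definition kernel_pair :: "'a measure \<Rightarrow> 'b measure \<Rightarrow> 'a measure \<Rightarrow> ('a \<Rightarrow> 'b measure) \<Rightarrow> ('a \<times> 'b) measure" where
  "kernel_pair N1 N2 P K = P \<bind> (\<lambda>y1. K y1 \<bind> (\<lambda>y2. return (N1 \<Otimes>\<^sub>M N2) (y1, y2)))"

lemma kernel_pair_in_prob_algebra: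
  assumes P: "P \<in> space (prob_algebra N1)" and K[measurable]: "K \<in> N1 \<rightarrow>\<^sub>M prob_algebra N2"
  shows "kernel_pair N1 N2 P K \<in> space (prob_algebra (N1 \<Otimes>\<^sub>M N2))"
proof -
  have "(\<lambda>P. kernel_pair N1 N2 P K) \<in> prob_algebra N1 \<rightarrow>\<^sub>M prob_algebra (N1 \<Otimes>\<^sub>M N2)"
    unfolding kernel_pair_def by measurable
  from measurable_space[OF this P] show ?thesis .
qed

text \<open>Tonelli for the semidirect product of \<open>P\<close> and \<open>K\<close>: the
  integral formula for a bind, applied to the outer and then to the inner bind.\<close>

lemma nn_integral_kernel_pair:
  assumes P: "P \<in> space (prob_algebra N1)" and K: "K \<in> N1 \<rightarrow>\<^sub>M prob_algebra N2"
    and F[measurable]: "F \<in> borel_measurable (N1 \<Otimes>\<^sub>M N2)"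
  shows "(\<integral>\<^sup>+y. F y \<partial>kernel_pair N1 N2 P K) = (\<integral>\<^sup>+y1. (\<integral>\<^sup>+y2. F (y1, y2) \<partial>K y1) \<partial>P)"
proof -
  have sP[measurable_cong, simp]: "sets P = sets N1" and pP: "prob_space P"
    using P by (auto simp: space_prob_algebra)
  have spP: "space P = space N1" using sP by (rule sets_eq_imp_space_eq)
  have K'[measurable]: "K \<in> N1 \<rightarrow>\<^sub>M subprob_algebra N2"
    using K by (rule measurable_prob_algebraD)
  have "(\<integral>\<^sup>+y. F y \<partial>kernel_pair N1 N2 P K)
      = (\<integral>\<^sup>+y1. (\<integral>\<^sup>+y. F y \<partial>(K y1 \<bind> (\<lambda>y2. return (N1 \<Otimes>\<^sub>M N2) (y1, y2)))) \<partial>P)"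
    unfolding kernel_pair_def
    by (rule nn_integral_bind[where B = "N1 \<Otimes>\<^sub>M N2"]) measurable
  also have "\<dots> = (\<integral>\<^sup>+y1. (\<integral>\<^sup>+y2. F (y1, y2) \<partial>K y1) \<partial>P)"
  proof (rule nn_integral_cong)
    fix y1 assume "y1 \<in> space P"
    then have y1[measurable]: "y1 \<in> space N1" by (simp add: spP)
    have sK[measurable_cong]: "sets (K y1) = sets N2"
      using measurable_space[OF K y1] by (auto simp: space_prob_algebra)
    have spK: "space (K y1) = space N2" using sK by (rule sets_eq_imp_space_eq)
    have "(\<integral>\<^sup>+y. F y \<partial>(K y1 \<bind> (\<lambda>y2. return (N1 \<Otimes>\<^sub>M N2) (y1, y2))))
       = (\<integral>\<^sup>+y2. (\<integral>\<^sup>+y. F y \<partial>return (N1 \<Otimes>\<^sub>M N2) (y1, y2)) \<partial>K y1)"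
    proof (rule nn_integral_bind[where B = "N1 \<Otimes>\<^sub>M N2"])
      have "(\<lambda>y2. return (N1 \<Otimes>\<^sub>M N2) (y1, y2)) \<in> N2 \<rightarrow>\<^sub>M subprob_algebra (N1 \<Otimes>\<^sub>M N2)"
        by measurable
      then show "(\<lambda>y2. return (N1 \<Otimes>\<^sub>M N2) (y1, y2)) \<in> K y1 \<rightarrow>\<^sub>M subprob_algebra (N1 \<Otimes>\<^sub>M N2)"
        by (simp add: measurable_cong_sets[OF sK refl])
    qed simp
    also have "\<dots> = (\<integral>\<^sup>+y2. F (y1, y2) \<partial>K y1)"
      by (intro nn_integral_cong nn_integral_return) (auto simp: spK y1 space_pair_measure)
    finally show "(\<integral>\<^sup>+y. F y \<partial>(K y1 \<bind> (\<lambda>y2. return (N1 \<Otimes>\<^sub>M N2) (y1, y2))))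
       = (\<integral>\<^sup>+y2. F (y1, y2) \<partial>K y1)" .
  qed
  finally show ?thesis .
qed

text \<open>Randomized tests. Integrating out later outcomes turns the indicator of an event into a
  conditional probability of acceptance, which takes values between 0 and 1; such functions are
  closed under sections and kernel integration.\<close>

definition unit_fun :: "'a measure \<Rightarrow> ('a \<Rightarrow> real) set" where
  "unit_fun N = {F \<in> borel_measurable N. \<forall>y\<in>space N. 0 \<le> F y \<and> F y \<le> 1}"

lemma unit_fun_integrable:
  assumes "P \<in> space (prob_algebra N)" "F \<in> unit_fun N"
  shows "integrable P F"
proof -
  have s: "sets P = sets N" and "prob_space P" using assms by (auto simp: space_prob_algebra)
  then interpret prob_space P by simp
  have [simp]: "space P = space N" using s by (rule sets_eq_imp_space_eq)
  have [measurable]: "F \<in> borel_measurable P"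
    using assms s by (auto simp: unit_fun_def cong: measurable_cong_sets)
  show ?thesis
    by (rule integrable_const_bound[where B=1]) (use assms in \<open>auto simp: unit_fun_def intro!: AE_I2\<close>)
qed

lemma unit_fun_integral:
  assumes "P \<in> space (prob_algebra N)" "F \<in> unit_fun N"
  shows "(\<integral>\<^sup>+y. F y \<partial>P) = ennreal (\<integral>y. F y \<partial>P)" "0 \<le> (\<integral>y. F y \<partial>P)" "(\<integral>y. F y \<partial>P) \<le> 1"
proof -
  have s: "sets P = sets N" and "prob_space P" using assms by (auto simp: space_prob_algebra)
  then interpret prob_space P by simp
  have [simp]: "space P = space N" using s by (rule sets_eq_imp_space_eq)
  note I = unit_fun_integrable[OF assms]
  show "(\<integral>\<^sup>+y. F y \<partial>P) = ennreal (\<integral>y. F y \<partial>P)"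
    by (rule nn_integral_eq_integral[OF I]) (use assms in \<open>auto simp: unit_fun_def\<close>)
  show "0 \<le> (\<integral>y. F y \<partial>P)"
    by (rule Bochner_Integration.integral_nonneg) (use assms in \<open>auto simp: unit_fun_def\<close>)
  show "(\<integral>y. F y \<partial>P) \<le> 1"
    by (rule integral_le_const[OF I]) (use assms in \<open>auto simp: unit_fun_def\<close>)
qed

lemma unit_fun_section:
  assumes "F \<in> unit_fun (N1 \<Otimes>\<^sub>M N2)" "y1 \<in> space N1"
  shows "(\<lambda>y2. F (y1, y2)) \<in> unit_fun N2"
  using assms by (auto simp: unit_fun_def space_pair_measure)

text \<open>Measurability in the parameter is taken from the nonnegative integral, which agrees with
  the Bochner integral on tests.\<close>

lemma unit_fun_kernel_integral:
  assumes K: "K \<in> N1 \<rightarrow>\<^sub>M prob_algebra N2" and F: "F \<in> unit_fun (N1 \<Otimes>\<^sub>M N2)"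
  shows "(\<lambda>y1. \<integral>y2. F (y1, y2) \<partial>K y1) \<in> unit_fun N1"
proof -
  have [measurable]: "F \<in> borel_measurable (N1 \<Otimes>\<^sub>M N2)" using F by (simp add: unit_fun_def)
  have K'[measurable]: "K \<in> N1 \<rightarrow>\<^sub>M subprob_algebra N2"
    using K by (rule measurable_prob_algebraD)
  have "(\<lambda>y1. enn2real (\<integral>\<^sup>+y2. F (y1, y2) \<partial>K y1)) \<in> borel_measurable N1"
    by (intro borel_measurable_enn2real nn_integral_measurable_subprob_algebra2[where N = N2]) measurable
  moreover have "enn2real (\<integral>\<^sup>+y2. F (y1, y2) \<partial>K y1) = (\<integral>y2. F (y1, y2) \<partial>K y1)"
    if "y1 \<in> space N1" for y1
    using unit_fun_integral[OF measurable_space[OF K that] unit_fun_section[OF F that]]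
    by simp
  ultimately have "(\<lambda>y1. \<integral>y2. F (y1, y2) \<partial>K y1) \<in> borel_measurable N1"
    by (simp cong: measurable_cong)
  then show ?thesis
    using unit_fun_integral(2,3)[OF measurable_space[OF K] unit_fun_section[OF F]]
    by (auto simp: unit_fun_def)
qed

lemma integral_kernel_pair:
  assumes P: "P \<in> space (prob_algebra N1)" and K: "K \<in> N1 \<rightarrow>\<^sub>M prob_algebra N2"
    and F: "F \<in> unit_fun (N1 \<Otimes>\<^sub>M N2)"
  shows "(\<integral>y. F y \<partial>kernel_pair N1 N2 P K) = (\<integral>y1. (\<integral>y2. F (y1, y2) \<partial>K y1) \<partial>P)"
proof -
  have [measurable]: "F \<in> borel_measurable (N1 \<Otimes>\<^sub>M N2)" using F by (simp add: unit_fun_def)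
  have spP: "space P = space N1"
    using P by (auto simp: space_prob_algebra dest: sets_eq_imp_space_eq)
  note KP = kernel_pair_in_prob_algebra[OF P K]
  have "ennreal (\<integral>y. F y \<partial>kernel_pair N1 N2 P K) = (\<integral>\<^sup>+y1. (\<integral>\<^sup>+y2. F (y1, y2) \<partial>K y1) \<partial>P)"
    by (simp add: unit_fun_integral(1)[OF KP F, symmetric] nn_integral_kernel_pair[OF P K])
  also have "\<dots> = (\<integral>\<^sup>+y1. ennreal (\<integral>y2. F (y1, y2) \<partial>K y1) \<partial>P)"
    by (intro nn_integral_cong unit_fun_integral(1)[OF measurable_space[OF K] unit_fun_section[OF F]])
       (simp_all add: spP)
  also have "\<dots> = ennreal (\<integral>y1. (\<integral>y2. F (y1, y2) \<partial>K y1) \<partial>P)"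
    by (rule unit_fun_integral(1)[OF P unit_fun_kernel_integral[OF K F]])
  finally show ?thesis
    using unit_fun_integral(2)[OF KP F]
      unit_fun_integral(2)[OF P unit_fun_kernel_integral[OF K F]] by simp
qed

lemma unit_fun_indicator: "S \<in> sets N \<Longrightarrow> indicator S \<in> unit_fun N"
  by (auto simp: unit_fun_def indicator_def)

text \<open>Peels the composition into one integral per step, so that the steps can be bounded from
  the innermost outwards.\<close>

lemma measure_kernel_pair:
  assumes P: "P \<in> space (prob_algebra N1)" and K2: "K2 \<in> N1 \<rightarrow>\<^sub>M prob_algebra N2"
    and K3: "K3 \<in> N1 \<Otimes>\<^sub>M N2 \<rightarrow>\<^sub>M prob_algebra N3"
    and S: "S \<in> sets ((N1 \<Otimes>\<^sub>M N2) \<Otimes>\<^sub>M N3)"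
  shows "measure (kernel_pair (N1 \<Otimes>\<^sub>M N2) N3 (kernel_pair N1 N2 P K2) K3) S
    = (\<integral>y1. (\<integral>y2. (\<integral>y3. indicator S ((y1, y2), y3) \<partial>K3 (y1, y2)) \<partial>K2 y1) \<partial>P)"
proof -
  note P2 = kernel_pair_in_prob_algebra[OF P K2]
  note P3 = kernel_pair_in_prob_algebra[OF P2 K3]
  note i = unit_fun_indicator[OF S]
  have "sets (kernel_pair (N1 \<Otimes>\<^sub>M N2) N3 (kernel_pair N1 N2 P K2) K3) = sets ((N1 \<Otimes>\<^sub>M N2) \<Otimes>\<^sub>M N3)"
    using P3 by (simp add: space_prob_algebra)
  then have "measure (kernel_pair (N1 \<Otimes>\<^sub>M N2) N3 (kernel_pair N1 N2 P K2) K3) S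
     = (\<integral>y. indicator S y \<partial>kernel_pair (N1 \<Otimes>\<^sub>M N2) N3 (kernel_pair N1 N2 P K2) K3)"
    using S sets.sets_into_space by (simp add: Int_absorb2)
  also have "\<dots> = (\<integral>y12. (\<integral>y3. indicator S (y12, y3) \<partial>K3 y12) \<partial>kernel_pair N1 N2 P K2)"
    by (rule integral_kernel_pair[OF P2 K3 i])
  also have "\<dots> = (\<integral>y1. (\<integral>y2. (\<integral>y3. indicator S ((y1, y2), y3) \<partial>K3 (y1, y2)) \<partial>K2 y1) \<partial>P)"
    by (rule integral_kernel_pair[OF P K2 unit_fun_kernel_integral[OF K3 i]])
  finally show ?thesis .
qed

subsection \<open>Bounded likelihood ratios\<close>

text \<open>The max-divergence of \<open>P\<close> from \<open>Q\<close> is at most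
  \<open>a\<close>. Comparing events rather than densities lets DP and BR mechanisms be treated
  alike.\<close>

definition dominated :: "real \<Rightarrow> 'a measure \<Rightarrow> 'a measure \<Rightarrow> bool" where
  "dominated a P Q \<longleftrightarrow> (\<forall>S\<in>sets P. measure P S \<le> exp a * measure Q S)"

text \<open>The comparison of events is the order relation between \<open>P\<close> and the measure
  \<open>Q\<close> scaled by \<open>exp a\<close>, and nonnegative integrals are monotone in the
  measure.\<close>

lemma dominated_integral_le:
  fixes s :: "'a \<Rightarrow> real"
  assumes P: "P \<in> space (prob_algebra N)" and Q: "Q \<in> space (prob_algebra N)"
    and d: "dominated a P Q"
    and s: "integrable P s" "integrable Q s" "\<And>y. y \<in> space N \<Longrightarrow> 0 \<le> s y"
  shows "(\<integral>y. s y \<partial>P) \<le> exp a * (\<integral>y. s y \<partial>Q)"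
proof -
  have sP: "sets P = sets N" "sets Q = sets N" and "prob_space P" "prob_space Q"
    using P Q by (auto simp: space_prob_algebra)
  interpret P: prob_space P by fact
  interpret Q: prob_space Q by fact
  have sp: "space P = space N" "space Q = space N" using sP by (auto dest: sets_eq_imp_space_eq)
  have le: "P \<le> scale_measure (ennreal (exp a)) Q"
    unfolding le_measure_iff
  proof (simp add: sP sp space_scale_measure le_fun_def, intro allI)
    fix S
    show "emeasure P S \<le> ennreal (exp a) * emeasure Q S"
    proof (cases "S \<in> sets P")
      case True
      then show ?thesis using d
        by (simp add: dominated_def P.emeasure_eq_measure Q.emeasure_eq_measure
            flip: ennreal_mult'')
    qed (simp add: emeasure_notin_sets)
  qed
  have "(\<integral>\<^sup>+y. s y \<partial>P) \<le> (\<integral>\<^sup>+y. s y \<partial>scale_measure (ennreal (exp a)) Q)"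
    by (rule nn_integral_mono_measure) (use le sP in auto)
  also have "\<dots> = ennreal (exp a) * (\<integral>\<^sup>+y. s y \<partial>Q)"
    by (rule nn_integral_scale_measure) (use s in auto)
  finally have "(\<integral>\<^sup>+y. s y \<partial>P) \<le> ennreal (exp a) * (\<integral>\<^sup>+y. s y \<partial>Q)" .
  moreover have ae: "AE y in P. 0 \<le> s y" "AE y in Q. 0 \<le> s y"
    by (auto intro!: AE_I2 simp: sp s(3))
  ultimately have "ennreal (\<integral>y. s y \<partial>P) \<le> ennreal (exp a) * ennreal (\<integral>y. s y \<partial>Q)"
    using nn_integral_eq_integral[OF s(1) ae(1)] nn_integral_eq_integral[OF s(2) ae(2)] by simp
  moreover have "0 \<le> (\<integral>y. s y \<partial>Q)"
    by (rule Bochner_Integration.integral_nonneg) (simp add: sp s)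
  ultimately show ?thesis
    by (simp add: zero_le_mult_iff flip: ennreal_mult'')
qed

text \<open>In a two-point pair with likelihood ratios \<open>u = exp a\<close> and
  \<open>v = exp (- b)\<close>, total mass one under both inputs forces the masses
  \<open>u (1 - v) / (u - v)\<close> and \<open>v (u - 1) / (u - v)\<close> under the first input;
  \<open>q (a + b) a\<close> is the former.\<close>

lemma q_sum:
  assumes "0 < a + b"
  shows "q (a + b) a = exp a * (1 - exp (- b)) / (exp a - exp (- b))"
    "1 - q (a + b) a = exp (- b) * (exp a - 1) / (exp a - exp (- b))"
proof -
  have *: "exp a - exp (- b) = exp a * (1 - exp (- (a + b)))" and n: "1 - exp (- (a + b)) \<noteq> 0"
    using assms by (simp_all add: algebra_simps flip: exp_add)
  show 1: "q (a + b) a = exp a * (1 - exp (- b)) / (exp a - exp (- b))"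
    unfolding * q_def using n by simp
  have n2: "exp a - exp (- b) \<noteq> 0" using assms by simp
  show "1 - q (a + b) a = exp (- b) * (exp a - 1) / (exp a - exp (- b))"
    unfolding 1 using n2 by (simp add: field_simps)
qed

text \<open>
  Integrating the nonnegative slacks \<open>s1\<close>, \<open>s2\<close> of the last two assumptions against the nonnegative
  measures \<open>P - exp (- b) Q\<close> and \<open>exp a Q - P\<close> replaces the decomposition of \<open>P\<close> and \<open>Q\<close> into
  the two outcomes of randomized response, so no densities are needed.
\<close>

lemma randomized_response_bound:
  assumes P: "P \<in> space (prob_algebra N)" and Q: "Q \<in> space (prob_algebra N)"
    and PQ: "dominated a P Q" and QP: "dominated b Q P" and ab: "0 < a + b"
    and g: "g \<in> unit_fun N" and h: "h \<in> unit_fun N"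
    and Ka: "\<And>y. y \<in> space N \<Longrightarrow> g y - exp (c - a) * h y \<le> Ka"
    and Kb: "\<And>y. y \<in> space N \<Longrightarrow> g y - exp (c + b) * h y \<le> Kb"
  shows "(\<integral>y. g y \<partial>P) - exp c * (\<integral>y. h y \<partial>Q) \<le> q (a + b) a * Ka + (1 - q (a + b) a) * Kb"
proof -
  define u v C where "u = exp a" and "v = exp (- b)" and "C = exp c"
  have uv: "v < u" "0 < u" "0 < v" using ab by (auto simp: u_def v_def)
  \<comment> \<open>The two pointwise bounds are scaled by \<open>exp a\<close> and
    \<open>exp (- b)\<close>, so that \<open>h\<close> carries the same coefficient
    \<open>exp c\<close> in both slacks.\<close>
  define s1 s2 where "s1 = (\<lambda>y. u * Ka + C * h y - u * g y)" and "s2 = (\<lambda>y. v * Kb + C * h y - v * g y)"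
  have "prob_space P" "prob_space Q" using P Q by (auto simp: space_prob_algebra)
  interpret P: prob_space P by fact
  interpret Q: prob_space Q by fact
  note [simp] = unit_fun_integrable[OF P g] unit_fun_integrable[OF Q g]
    unit_fun_integrable[OF P h] unit_fun_integrable[OF Q h] P.prob_space Q.prob_space
  have i: "integrable P s1" "integrable Q s1" "integrable P s2" "integrable Q s2"
    by (simp_all add: s1_def s2_def)
  have "0 \<le> s1 y" if "y \<in> space N" for y
  proof -
    have "u * (g y - exp (c - a) * h y) \<le> u * Ka" using Ka[OF that] uv by simp
    moreover have "u * exp (c - a) = C" by (simp add: u_def C_def flip: exp_add)
    ultimately show ?thesis by (simp add: s1_def right_diff_distrib flip: mult.assoc)
  qed
  then have "(\<integral>y. s1 y \<partial>Q) \<le> exp b * (\<integral>y. s1 y \<partial>P)"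
    by (intro dominated_integral_le[OF Q P QP] i)
  then have "v * (\<integral>y. s1 y \<partial>Q) \<le> v * (exp b * (\<integral>y. s1 y \<partial>P))" using uv by simp
  then have 1: "v * (\<integral>y. s1 y \<partial>Q) \<le> (\<integral>y. s1 y \<partial>P)"
    by (simp add: v_def exp_minus flip: mult.assoc)
  have "0 \<le> s2 y" if "y \<in> space N" for y
  proof -
    have "v * (g y - exp (c + b) * h y) \<le> v * Kb" using Kb[OF that] uv by simp
    moreover have "v * exp (c + b) = C" by (simp add: v_def C_def flip: exp_add)
    ultimately show ?thesis by (simp add: s2_def right_diff_distrib flip: mult.assoc)
  qed
  then have 2: "(\<integral>y. s2 y \<partial>P) \<le> u * (\<integral>y. s2 y \<partial>Q)"
    unfolding u_def by (intro dominated_integral_le[OF P Q PQ] i)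
  define gP gQ hP hQ where "gP = (\<integral>y. g y \<partial>P)" "gQ = (\<integral>y. g y \<partial>Q)" "hP = (\<integral>y. h y \<partial>P)" "hQ = (\<integral>y. h y \<partial>Q)"
  have e: "(\<integral>y. s1 y \<partial>P) = u * Ka + C * hP - u * gP" "(\<integral>y. s1 y \<partial>Q) = u * Ka + C * hQ - u * gQ"
    "(\<integral>y. s2 y \<partial>P) = v * Kb + C * hP - v * gP" "(\<integral>y. s2 y \<partial>Q) = v * Kb + C * hQ - v * gQ"
    by (simp_all add: s1_def s2_def gP_gQ_hP_hQ_def)
  \<comment> \<open>Adding \<open>1\<close> and \<open>2\<close> cancels the terms in
    \<open>gQ\<close> and \<open>hP\<close>.\<close>
  have "(u - v) * (gP - C * hQ) \<le> u * (1 - v) * Ka + v * (u - 1) * Kb"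
    using 1 2 unfolding e by (simp add: algebra_simps)
  then have "gP - C * hQ \<le> (u * (1 - v) * Ka + v * (u - 1) * Kb) / (u - v)"
    using uv by (simp add: pos_le_divide_eq mult.commute)
  also have "\<dots> = q (a + b) a * Ka + (1 - q (a + b) a) * Kb"
    unfolding q_sum(2)[OF ab] unfolding q_sum(1)[OF ab] by (simp add: u_def v_def add_divide_distrib)
  finally show ?thesis by (simp add: gP_gQ_hP_hQ_def C_def)
qed

text \<open>Let \<open>c\<close> be the supremum of the likelihood ratio. Bounded range confines the
  ratio to the interval from \<open>exp (- \<epsilon>) * c\<close> to \<open>c\<close>, so
  \<open>t = ln c\<close>; as both laws have total mass one, this interval contains 1.\<close>

lemma BR_class_dominated:
  assumes BR: "(N, M) \<in> BR_class nb \<epsilon>" and nb: "nb x x'"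
  shows "\<exists>t. 0 \<le> t \<and> t \<le> \<epsilon> \<and> dominated t (M x) (M x') \<and> dominated (\<epsilon> - t) (M x') (M x)"
proof -
  have mech: "M z \<in> space (prob_algebra N)" for z
    using BR by (auto simp: BR_class_def is_mechanism_def)
  have "prob_space (M x)" "prob_space (M x')" using mech by (auto simp: space_prob_algebra)
  interpret P: prob_space "M x" by fact
  interpret Q: prob_space "M x'" by fact
  from BR have "is_BR nb \<epsilon> (N, M)" by (simp add: BR_class_def)
  from this[unfolded is_BR_def prod.case, rule_format, OF nb]
  obtain \<mu> f f' where [measurable]: "f \<in> borel_measurable \<mu>" "f' \<in> borel_measurable \<mu>"
    and nn: "\<And>y. y \<in> space \<mu> \<Longrightarrow> 0 \<le> f y" "\<And>y. y \<in> space \<mu> \<Longrightarrow> 0 \<le> f' y"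
    and P: "M x = density \<mu> (\<lambda>y. ennreal (f y))" and Q: "M x' = density \<mu> (\<lambda>y. ennreal (f' y))"
    and br: "\<And>y1 y2. y1 \<in> space \<mu> \<Longrightarrow> y2 \<in> space \<mu> \<Longrightarrow> f y1 * f' y2 \<le> exp \<epsilon> * (f y2 * f' y1)"
    by (elim exE conjE) (rule that, auto)
  have pos: "\<exists>y\<in>space \<mu>. 0 < k y"
    if "prob_space (density \<mu> (\<lambda>y. ennreal (k y)))" and [measurable]: "k \<in> borel_measurable \<mu>"
    for k :: "_ \<Rightarrow> real"
  proof (rule ccontr)
    assume "\<not> ?thesis"
    then have "(\<integral>\<^sup>+y. ennreal (k y) * indicator (space \<mu>) y \<partial>\<mu>) = (\<integral>\<^sup>+y. 0 \<partial>\<mu>)"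
      by (intro nn_integral_cong) (simp add: not_less ennreal_neg)
    then have "emeasure (density \<mu> (\<lambda>y. ennreal (k y))) (space \<mu>) = 0"
      by (simp add: emeasure_density)
    then show False using prob_space.emeasure_space_1[OF that(1)] by simp
  qed
  obtain y0 where y0: "y0 \<in> space \<mu>" "0 < f' y0"
    using pos[of f'] Q \<open>prob_space (M x')\<close> by auto
  obtain y1 where y1: "y1 \<in> space \<mu>" "0 < f y1"
    using pos[of f] P \<open>prob_space (M x)\<close> by auto
  \<comment> \<open>Ratios are collected where \<open>f'\<close> is positive. At points with
    \<open>f' y = 0\<close>, comparison with \<open>y0\<close> forces \<open>f y = 0\<close> as
    well.\<close>
  define A where "A = {f y / f' y | y. y \<in> space \<mu> \<and> 0 < f' y}"
  define c where "c = Sup A"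
  have ub: "a \<le> exp \<epsilon> * (f y / f' y)" if "a \<in> A" "y \<in> space \<mu>" "0 < f' y" for a y
    using that br[of _ y] unfolding A_def by (auto simp: field_simps)
  have ne: "A \<noteq> {}" using y0 by (auto simp: A_def)
  have bdd: "bdd_above A" using ub y0 by (intro bdd_aboveI) auto
  have fc: "f y \<le> c * f' y" if y: "y \<in> space \<mu>" for y
  proof (cases "f' y = 0")
    case True
    then have "f y * f' y0 \<le> 0" using br[OF y y0(1)] by simp
    then show ?thesis using True y0 nn(1)[OF y] by (simp add: mult_le_0_iff)
  next
    case False
    then have p: "0 < f' y" using nn(2)[OF y] by simp
    then have "f y / f' y \<le> c" unfolding c_def using y by (intro cSup_upper bdd) (auto simp: A_def)
    then show ?thesis using p by (simp add: field_simps)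
  qed
  have cf: "c * f' y \<le> exp \<epsilon> * f y" if y: "y \<in> space \<mu>" for y
  proof (cases "f' y = 0")
    case True
    then show ?thesis using nn(1)[OF y] by simp
  next
    case False
    then have p: "0 < f' y" using nn(2)[OF y] by simp
    then have "c \<le> exp \<epsilon> * (f y / f' y)" unfolding c_def using ub y by (intro cSup_least ne) auto
    then show ?thesis using p by (simp add: field_simps)
  qed
  have c0: "0 < c"
  proof -
    have "0 < c * f' y1" using fc[OF y1(1)] y1 by simp
    then show ?thesis using nn(2)[OF y1(1)] by (simp add: zero_less_mult_iff)
  qed
  have dens: "measure (density \<mu> (\<lambda>y. ennreal (k y))) S \<le> r * measure (density \<mu> (\<lambda>y. ennreal (k' y))) S"
    if "\<And>y. y \<in> space \<mu> \<Longrightarrow> k y \<le> r * k' y" "0 \<le> r" "S \<in> sets \<mu>"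
      and [measurable]: "k \<in> borel_measurable \<mu>" "k' \<in> borel_measurable \<mu>"
      and nn': "\<And>y. y \<in> space \<mu> \<Longrightarrow> 0 \<le> k' y"
      and pr: "prob_space (density \<mu> (\<lambda>y. ennreal (k y)))" "prob_space (density \<mu> (\<lambda>y. ennreal (k' y)))"
    for r S and k k' :: "_ \<Rightarrow> real"
  proof -
    have [measurable]: "S \<in> sets \<mu>" by fact
    interpret k: prob_space "density \<mu> (\<lambda>y. ennreal (k y))" by fact
    interpret k': prob_space "density \<mu> (\<lambda>y. ennreal (k' y))" by fact
    have "(\<integral>\<^sup>+y. ennreal (k y) * indicator S y \<partial>\<mu>)
        \<le> (\<integral>\<^sup>+y. ennreal r * (ennreal (k' y) * indicator S y) \<partial>\<mu>)"
    proof (rule nn_integral_mono)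
      fix y assume "y \<in> space \<mu>"
      then have "ennreal (k y) \<le> ennreal (r * k' y)" using that(1) by (intro ennreal_leI)
      then show "ennreal (k y) * indicator S y \<le> ennreal r * (ennreal (k' y) * indicator S y)"
        using \<open>0 \<le> r\<close> nn' \<open>y \<in> space \<mu>\<close> by (auto simp: ennreal_mult split: split_indicator)
    qed
    also have "\<dots> = ennreal r * (\<integral>\<^sup>+y. ennreal (k' y) * indicator S y \<partial>\<mu>)"
      by (rule nn_integral_cmult) measurable
    finally have "emeasure (density \<mu> (\<lambda>y. ennreal (k y))) S
       \<le> ennreal r * emeasure (density \<mu> (\<lambda>y. ennreal (k' y))) S"
      by (simp add: emeasure_density)
    then show ?thesis
      using \<open>0 \<le> r\<close> by (simp add: k.emeasure_eq_measure k'.emeasure_eq_measure flip: ennreal_mult)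
  qed
  have d1: "measure (M x) S \<le> c * measure (M x') S" if "S \<in> sets \<mu>" for S
    unfolding P Q by (rule dens) (use c0 fc nn that \<open>prob_space (M x)\<close> \<open>prob_space (M x')\<close> P Q in auto)
  have cf': "f' y \<le> (exp \<epsilon> / c) * f y" if "y \<in> space \<mu>" for y
    using cf[OF that] c0 by (simp add: field_simps)
  have d2: "measure (M x') S \<le> (exp \<epsilon> / c) * measure (M x) S" if "S \<in> sets \<mu>" for S
    unfolding P Q by (rule dens) (use c0 cf' nn that \<open>prob_space (M x)\<close> \<open>prob_space (M x')\<close> P Q in auto)
  have sm: "sets (M x) = sets \<mu>" "sets (M x') = sets \<mu>" "space (M x) = space \<mu>" "space (M x') = space \<mu>"
    by (simp_all add: P Q)
  \<comment> \<open>Both dominations at the whole space, where the masses are one, place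
    \<open>c\<close> between 1 and \<open>exp \<epsilon>\<close>.\<close>
  have "1 \<le> c" using d1[of "space \<mu>"] P.prob_space Q.prob_space by (simp add: sm)
  moreover have "c \<le> exp \<epsilon>"
    using d2[of "space \<mu>"] P.prob_space Q.prob_space c0 by (simp add: sm)
  moreover have "dominated (ln c) (M x) (M x')" "dominated (\<epsilon> - ln c) (M x') (M x)"
    using d1 d2 c0 by (simp_all add: dominated_def sm exp_diff)
  moreover have "ln c \<le> \<epsilon>" using \<open>c \<le> exp \<epsilon>\<close> c0 ln_le_cancel_iff[of c "exp \<epsilon>"] by simp
  ultimately show ?thesis
    by (intro exI[of _ "ln c"]) simp
qed

subsection \<open>The last step\<close>

text \<open>
  \<open>rr_mix a b K c\<close> is the value of continuing with \<open>K\<close> after a two-point mechanism with log-likelihood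
  ratios \<open>a\<close> and \<open>- b\<close>; the remaining budget is \<open>c\<close> minus the realized ratio.
\<close>

definition rr_mix :: "real \<Rightarrow> real \<Rightarrow> (real \<Rightarrow> real) \<Rightarrow> real \<Rightarrow> real" where
  "rr_mix a b K c = q (a + b) a * K (c - a) + (1 - q (a + b) a) * K (c + b)"

text \<open>The optimal \<delta> of a single bounded-range mechanism at budget \<open>c\<close>.
  Budgets outside the range from \<open>- \<epsilon>\<close> to \<open>\<epsilon>\<close> arise once
  earlier log-ratios have been subtracted: below it every outcome is worth accepting, above it none
  is.\<close>

definition br_opt :: "real \<Rightarrow> real \<Rightarrow> real" where
  "br_opt \<epsilon> c = (if c \<le> - \<epsilon> then 1 - exp c
     else if c \<le> \<epsilon> then (1 - exp ((c - \<epsilon>) / 2))\<^sup>2 / (1 - exp (- \<epsilon>)) else 0)"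

text \<open>The parameter attaining \<open>br_opt\<close>: \<open>(c + \<epsilon>) / 2\<close> makes
  the two factors in \<open>br_mid_le\<close> equal, and is clamped to the admissible
  interval.\<close>

definition br_arg :: "real \<Rightarrow> real \<Rightarrow> real" where
  "br_arg \<epsilon> c = max 0 (min \<epsilon> ((c + \<epsilon>) / 2))"

lemma q_bounds:
  assumes "0 \<le> a" "0 \<le> b" "0 < a + b"
  shows "0 \<le> q (a + b) a" "q (a + b) a \<le> 1"
  using assms by (simp_all add: q_def)

text \<open>The summands are the masses of the two outcomes under the second input, so they add up
  to one.\<close>

lemma q_inverse_mean:
  assumes "0 < a + b"
  shows "exp (- a) * q (a + b) a + exp b * (1 - q (a + b) a) = 1"
proof -
  have n: "exp a - exp (- b) \<noteq> 0" using assms by simp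
  have "exp (- a) * q (a + b) a = (1 - exp (- b)) / (exp a - exp (- b))"
    unfolding q_sum(1)[OF assms] by (simp add: exp_minus)
  moreover have "exp b * (1 - q (a + b) a) = (exp a - 1) / (exp a - exp (- b))"
    unfolding q_sum(2)[OF assms] by (simp add: exp_minus)
  ultimately show ?thesis
    using n by (simp flip: add_divide_distrib)
qed

text \<open>\<open>max 0 (1 - exp c)\<close> is the value after the last outcome, where one accepts
  exactly at negative budget. The cases are that both outcomes, only the upper one, or neither is
  worth accepting; in the first, \<open>q_inverse_mean\<close> collapses the sum.\<close>

lemma rr_mix_br_cases:
  assumes "0 < \<epsilon>" "0 \<le> t" "t \<le> \<epsilon>"
  shows "rr_mix t (\<epsilon> - t) (\<lambda>c. max 0 (1 - exp c)) c =
    (if c \<le> t - \<epsilon> then 1 - exp c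
     else if c \<le> t then (1 - exp (t - \<epsilon>)) * (1 - exp (c - t)) / (1 - exp (- \<epsilon>)) else 0)"
proof -
  have n: "1 - exp (- \<epsilon>) \<noteq> 0" using assms by simp
  consider "c \<le> t - \<epsilon>" | "t - \<epsilon> < c" "c \<le> t" | "t < c" by linarith
  then show ?thesis
  proof cases
    case 1
    have "q \<epsilon> t * (1 - exp (c - t)) + (1 - q \<epsilon> t) * (1 - exp (c + (\<epsilon> - t)))
        = 1 - exp c * (exp (- t) * q \<epsilon> t + exp (\<epsilon> - t) * (1 - q \<epsilon> t))"
      by (simp add: exp_add exp_diff exp_minus field_simps)
    also have "\<dots> = 1 - exp c" using q_inverse_mean[of t "\<epsilon> - t"] assms by simp
    finally have "q \<epsilon> t * (1 - exp (c - t)) + (1 - q \<epsilon> t) * (1 - exp (c + (\<epsilon> - t))) = 1 - exp c" .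
    then show ?thesis using 1 assms by (simp add: rr_mix_def max_def)
  next
    case 2
    then show ?thesis using assms by (simp add: rr_mix_def max_def q_def)
  next
    case 3
    then show ?thesis using assms by (simp add: rr_mix_def max_def)
  qed
qed

lemma exp_half_sq: "exp ((x::real) / 2) ^ 2 = exp x"
  by (simp add: power2_eq_square flip: exp_add)

text \<open>AM-GM: the sides are \<open>(1 - A^2) (1 - B^2)\<close> and \<open>(1 - A B)^2\<close>,
  which differ by \<open>(A - B)^2\<close>, and \<open>A B\<close> does not depend on
  \<open>t\<close>.\<close>

lemma br_mid_le:
  fixes t c \<epsilon> :: real
  shows "(1 - exp (t - \<epsilon>)) * (1 - exp (c - t)) \<le> (1 - exp ((c - \<epsilon>) / 2))\<^sup>2"
proof -
  define A B where "A = exp ((t - \<epsilon>) / 2)" "B = exp ((c - t) / 2)"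
  have e: "exp (t - \<epsilon>) = A ^ 2" "exp (c - t) = B ^ 2" "exp ((c - \<epsilon>) / 2) = A * B"
    by (simp_all add: A_B_def exp_half_sq) (simp add: add_divide_distrib diff_divide_distrib flip: exp_add)
  have "0 \<le> (A - B)\<^sup>2" by simp
  then show ?thesis unfolding e by (simp add: power2_eq_square algebra_simps)
qed

lemma rr_mix_le_br_opt:
  assumes "0 < \<epsilon>" "0 \<le> t" "t \<le> \<epsilon>"
  shows "rr_mix t (\<epsilon> - t) (\<lambda>c. max 0 (1 - exp c)) c \<le> br_opt \<epsilon> c"
proof -
  have p: "0 < 1 - exp (- \<epsilon>)" using assms by simp
  have mid: "(1 - exp (t - \<epsilon>)) * (1 - exp (c - t)) / (1 - exp (- \<epsilon>))
      \<le> (1 - exp ((c - \<epsilon>) / 2))\<^sup>2 / (1 - exp (- \<epsilon>))" for t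
    using br_mid_le p by (intro divide_right_mono) auto
  \<comment> \<open>At \<open>t = c + \<epsilon>\<close> the second factor equals the denominator
    and the first is \<open>1 - exp c\<close>.\<close>
  have low: "1 - exp c \<le> (1 - exp ((c - \<epsilon>) / 2))\<^sup>2 / (1 - exp (- \<epsilon>))"
    using mid[of "c + \<epsilon>"] p by simp
  have nn: "0 \<le> (1 - exp ((c - \<epsilon>) / 2))\<^sup>2 / (1 - exp (- \<epsilon>))" using p by simp
  show ?thesis
    unfolding rr_mix_br_cases[OF assms] br_opt_def using assms mid[of t] low nn by auto
qed

lemma rr_mix_br_arg:
  assumes "0 < \<epsilon>"
  shows "rr_mix (br_arg \<epsilon> c) (\<epsilon> - br_arg \<epsilon> c) (\<lambda>c. max 0 (1 - exp c)) c = br_opt \<epsilon> c"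
proof -
  have b: "0 \<le> br_arg \<epsilon> c" "br_arg \<epsilon> c \<le> \<epsilon>" using assms by (auto simp: br_arg_def)
  consider "c \<le> - \<epsilon>" | "- \<epsilon> < c" "c \<le> \<epsilon>" | "\<epsilon> < c" by linarith
  then show ?thesis
  proof cases
    case 1
    then have "(c + \<epsilon>) / 2 \<le> 0" by simp
    then have "br_arg \<epsilon> c = 0" unfolding br_arg_def by linarith
    then show ?thesis using 1 assms by (subst rr_mix_br_cases) (auto simp: br_opt_def)
  next
    case 2
    then have a: "br_arg \<epsilon> c = (c + \<epsilon>) / 2" by (simp add: br_arg_def)
    have e: "c - (c + \<epsilon>) / 2 = (c - \<epsilon>) / 2" "(c + \<epsilon>) / 2 - \<epsilon> = (c - \<epsilon>) / 2" by (simp_all add: field_simps)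
    show ?thesis
      unfolding rr_mix_br_cases[OF assms b] unfolding a e using 2 assms
      by (auto simp: br_opt_def power2_eq_square)
  next
    case 3
    then have "br_arg \<epsilon> c = \<epsilon>" using assms by (simp add: br_arg_def)
    then show ?thesis using 3 assms by (subst rr_mix_br_cases) (auto simp: br_opt_def)
  qed
qed

subsection \<open>Upper bound for threefold compositions\<close>

text \<open>Common form of the DP and BR classes for the upper bound: each pair of neighbors has
  log-ratios between \<open>- b\<close> and \<open>a\<close> for some \<open>(a, b)\<close> in
  \<open>R\<close>. For DP, \<open>R\<close> is one point; for BR it is the segment
  \<open>a + b = \<epsilon>\<close>.\<close>

definition likelihood_class :: "('x \<Rightarrow> 'x \<Rightarrow> bool) \<Rightarrow> (real \<times> real) set \<Rightarrow> ('x, 'y) mechanism set \<Rightarrow> bool" where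
  "likelihood_class nb R C \<longleftrightarrow> (\<forall>a b. (a, b) \<in> R \<longrightarrow> 0 \<le> a \<and> 0 \<le> b \<and> 0 < a + b) \<and>
     (\<forall>N M. (N, M) \<in> C \<longrightarrow> is_mechanism (N, M) \<and>
       (\<forall>x x'. nb x x' \<longrightarrow>
         (\<exists>a b. (a, b) \<in> R \<and> dominated a (M x) (M x') \<and> dominated b (M x') (M x))))"

definition br_params :: "real \<Rightarrow> (real \<times> real) set" where
  "br_params \<epsilon> = {(t, \<epsilon> - t) | t. 0 \<le> t \<and> t \<le> \<epsilon>}"

text \<open>Symmetry of the neighboring relation supplies the domination in the reverse
  direction.\<close>

lemma likelihood_class_DP:
  "0 < \<epsilon> \<Longrightarrow> symp nb \<Longrightarrow> likelihood_class nb {(\<epsilon>, \<epsilon>)} (DP_class nb \<epsilon>)"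
  unfolding likelihood_class_def
  by (auto dest: sympD simp: DP_class_def is_mechanism_def is_DP_def dominated_def space_prob_algebra)

lemma likelihood_class_BR:
  assumes "0 < \<epsilon>"
  shows "likelihood_class nb (br_params \<epsilon>) (BR_class nb \<epsilon>)"
proof -
  have "\<exists>a b. (a, b) \<in> br_params \<epsilon> \<and> dominated a (M x) (M x') \<and> dominated b (M x') (M x)"
    if "(N, M) \<in> BR_class nb \<epsilon>" "nb x x'" for N x x' and M :: "_ \<Rightarrow> 'b measure"
    using BR_class_dominated[OF that] by (auto simp: br_params_def)
  then show ?thesis
    using assms unfolding likelihood_class_def by (fastforce simp: br_params_def BR_class_def)
qed

lemma adaptive_comp_eq:
  "C1 \<triangleright> C2 = {(N1 \<Otimes>\<^sub>M N2, \<lambda>x. kernel_pair N1 N2 (M1 x) (M2 x)) | N1 N2 M1 M2.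
        (N1, M1) \<in> C1 \<and> (\<forall>x. M2 x \<in> N1 \<rightarrow>\<^sub>M prob_algebra N2) \<and>
        (\<forall>y1\<in>space N1. (N2, \<lambda>x. M2 x y1) \<in> C2)}"
  by (simp add: adaptive_comp_def kernel_pair_def)

lemma adaptive_compI:
  assumes "(N1, M1) \<in> C1" "\<And>x. M2 x \<in> N1 \<rightarrow>\<^sub>M prob_algebra N2"
    and "\<And>y1. y1 \<in> space N1 \<Longrightarrow> (N2, \<lambda>x. M2 x y1) \<in> C2"
  shows "(N1 \<Otimes>\<^sub>M N2, \<lambda>x. kernel_pair N1 N2 (M1 x) (M2 x)) \<in> C1 \<triangleright> C2"
  unfolding adaptive_comp_eq using assms by blast

text \<open>One test serves as both \<open>g\<close> and \<open>h\<close>, so an outcome pays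
  \<open>F y * (1 - exp c')\<close>, at most the positive part of \<open>1 - exp c'\<close>.\<close>

lemma BR_hockey_stick_bound:
  assumes M: "(N, M) \<in> BR_class nb \<epsilon>" and nb: "nb x x'" and eps: "0 < \<epsilon>" and F: "F \<in> unit_fun N"
  shows "(\<integral>y. F y \<partial>M x) - exp c * (\<integral>y. F y \<partial>M x') \<le> br_opt \<epsilon> c"
proof -
  have mech: "M z \<in> space (prob_algebra N)" for z using M by (auto simp: BR_class_def is_mechanism_def)
  obtain t where t: "0 \<le> t" "t \<le> \<epsilon>" and d: "dominated t (M x) (M x')" "dominated (\<epsilon> - t) (M x') (M x)"
    using BR_class_dominated[OF M nb] by blast
  have K: "F y - exp c' * F y \<le> max 0 (1 - exp c')" if "y \<in> space N" for y c'
  proof -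
    have "0 \<le> F y" "F y \<le> 1" using F that by (auto simp: unit_fun_def)
    then have "F y * (1 - exp c') \<le> F y * max 0 (1 - exp c')" "F y * max 0 (1 - exp c') \<le> 1 * max 0 (1 - exp c')"
      by (intro mult_left_mono mult_right_mono; simp)+
    then show ?thesis by (simp add: algebra_simps)
  qed
  have "(\<integral>y. F y \<partial>M x) - exp c * (\<integral>y. F y \<partial>M x')
     \<le> rr_mix t (\<epsilon> - t) (\<lambda>c. max 0 (1 - exp c)) c"
    unfolding rr_mix_def
    by (rule randomized_response_bound[OF mech mech d _ F F K K]) (use eps in auto)
  also have "\<dots> \<le> br_opt \<epsilon> c" by (rule rr_mix_le_br_opt[OF eps t])
  finally show ?thesis .
qed

text \<open>Backward induction over the three steps. \<open>Ka\<close> and \<open>Kb\<close> bound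
  the second step separately after the two extreme outcomes of the first, because its parameters may
  depend on \<open>y1\<close>.\<close>

lemma composition_upper_bound:
  assumes m: "(N, M) \<in> C1 \<triangleright> C2 \<triangleright> BR_class nb \<epsilon>" and nb: "nb x x'" and eps: "0 < \<epsilon>"
    and R1: "likelihood_class nb R1 C1" and R2: "likelihood_class nb R2 C2"
    and V: "\<And>a b. (a, b) \<in> R1 \<Longrightarrow> \<exists>Ka Kb.
      (\<forall>a' b'. (a', b') \<in> R2 \<longrightarrow> rr_mix a' b' (br_opt \<epsilon>) (c - a) \<le> Ka \<and> rr_mix a' b' (br_opt \<epsilon>) (c + b) \<le> Kb) \<and>
      q (a + b) a * Ka + (1 - q (a + b) a) * Kb \<le> V"
    and S: "S \<in> sets N"
  shows "measure (M x) S - exp c * measure (M x') S \<le> V"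
proof -
  from m obtain N1 N2 N3 M1 M2 M3 where NM: "N = (N1 \<Otimes>\<^sub>M N2) \<Otimes>\<^sub>M N3"
      "M = (\<lambda>x. kernel_pair (N1 \<Otimes>\<^sub>M N2) N3 (kernel_pair N1 N2 (M1 x) (M2 x)) (M3 x))"
    and M1: "(N1, M1) \<in> C1" and k2: "\<And>x. M2 x \<in> N1 \<rightarrow>\<^sub>M prob_algebra N2"
    and k3: "\<And>x. M3 x \<in> N1 \<Otimes>\<^sub>M N2 \<rightarrow>\<^sub>M prob_algebra N3"
    and M2: "\<And>y1. y1 \<in> space N1 \<Longrightarrow> (N2, \<lambda>x. M2 x y1) \<in> C2"
    and M3: "\<And>y. y \<in> space (N1 \<Otimes>\<^sub>M N2) \<Longrightarrow> (N3, \<lambda>x. M3 x y) \<in> BR_class nb \<epsilon>"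
    unfolding adaptive_comp_eq by blast
  have p1: "M1 z \<in> space (prob_algebra N1)" for z
    using R1 M1 by (auto simp: likelihood_class_def is_mechanism_def)
  have p2: "M2 z y \<in> space (prob_algebra N2)" if "y \<in> space N1" for z y
    using measurable_space[OF k2 that] .
  have S': "S \<in> sets ((N1 \<Otimes>\<^sub>M N2) \<Otimes>\<^sub>M N3)" using S by (simp add: NM)
  note i = unit_fun_indicator[OF S']
  \<comment> \<open>\<open>g3\<close> and \<open>g2\<close> are the probabilities of
    \<open>S\<close> given the first two outcomes and given the first one.\<close>
  define g3 where "g3 = (\<lambda>z y12. \<integral>y3. indicator S (y12, y3) \<partial>M3 z y12 :: real)"
  define g2 where "g2 = (\<lambda>z y1. \<integral>y2. g3 z (y1, y2) \<partial>M2 z y1)"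
  have u3: "g3 z \<in> unit_fun (N1 \<Otimes>\<^sub>M N2)" for z
    unfolding g3_def by (rule unit_fun_kernel_integral[OF k3 i])
  have u2: "g2 z \<in> unit_fun N1" for z
    unfolding g2_def by (rule unit_fun_kernel_integral[OF k2 u3])
  have eq: "measure (M z) S = (\<integral>y. g2 z y \<partial>M1 z)" for z
    unfolding NM g2_def g3_def by (rule measure_kernel_pair[OF p1 k2 k3 S'])
  have b3: "g3 x y - exp c' * g3 x' y \<le> br_opt \<epsilon> c'" if "y \<in> space (N1 \<Otimes>\<^sub>M N2)" for y c'
    unfolding g3_def
    by (rule BR_hockey_stick_bound[OF M3[OF that] nb eps unit_fun_section[OF i that]])
  have b2: "\<exists>a' b'. (a', b') \<in> R2 \<and> (\<forall>c'. g2 x y - exp c' * g2 x' y \<le> rr_mix a' b' (br_opt \<epsilon>) c')"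
    if y: "y \<in> space N1" for y
  proof -
    obtain a' b' where ab: "(a', b') \<in> R2" and d: "dominated a' (M2 x y) (M2 x' y)" "dominated b' (M2 x' y) (M2 x y)"
      using R2 M2[OF y] nb unfolding likelihood_class_def by blast
    have pos: "0 < a' + b'" using R2 ab by (auto simp: likelihood_class_def)
    have "g2 x y - exp c' * g2 x' y \<le> rr_mix a' b' (br_opt \<epsilon>) c'" for c'
      unfolding g2_def rr_mix_def
      by (rule randomized_response_bound[OF p2[OF y] p2[OF y] d pos unit_fun_section[OF u3 y] unit_fun_section[OF u3 y]])
         (use b3 y in \<open>auto simp: space_pair_measure\<close>)
    then show ?thesis using ab by blast
  qed
  obtain a b where ab: "(a, b) \<in> R1" and d: "dominated a (M1 x) (M1 x')" "dominated b (M1 x') (M1 x)"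
    using R1 M1 nb unfolding likelihood_class_def by blast
  have pos: "0 < a + b" using R1 ab by (auto simp: likelihood_class_def)
  obtain Ka Kb where K: "\<And>a' b'. (a', b') \<in> R2 \<Longrightarrow> rr_mix a' b' (br_opt \<epsilon>) (c - a) \<le> Ka"
      "\<And>a' b'. (a', b') \<in> R2 \<Longrightarrow> rr_mix a' b' (br_opt \<epsilon>) (c + b) \<le> Kb"
    and le: "q (a + b) a * Ka + (1 - q (a + b) a) * Kb \<le> V"
    using V[OF ab] by blast
  have "measure (M x) S - exp c * measure (M x') S \<le> q (a + b) a * Ka + (1 - q (a + b) a) * Kb"
    unfolding eq
    by (rule randomized_response_bound[OF p1 p1 d pos u2 u2])
       (use b2 K in \<open>meson order_trans\<close>)+
  with le show ?thesis by simp
qed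

subsection \<open>Randomized response\<close>

text \<open>\<open>u\<close> has log-likelihood ratio \<open>a\<close>, any other point
  \<open>- b\<close>. The flag \<open>z\<close> marks the first of the two inputs; masses under the
  second are those under the first divided by the ratio.\<close>

definition rr_density :: "real \<Rightarrow> real \<Rightarrow> 'y \<Rightarrow> bool \<Rightarrow> 'y \<Rightarrow> real" where
  "rr_density a b u z y =
    (if y = u then (if z then 1 else exp (- a)) * q (a + b) a
     else (if z then 1 else exp b) * (1 - q (a + b) a))"

text \<open>The outcome space is cut down to two points, so that the same pair of laws lives in
  every type with two elements.\<close>

definition rr :: "real \<Rightarrow> real \<Rightarrow> 'y \<Rightarrow> 'y \<Rightarrow> bool \<Rightarrow> 'y measure" where
  "rr a b u v z = density (count_space {u, v}) (\<lambda>y. ennreal (rr_density a b u z y))"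

lemma rr_density_nonneg:
  assumes "0 \<le> a" "0 \<le> b" "0 < a + b"
  shows "0 \<le> rr_density a b u z y"
  using q_bounds[OF assms] by (simp add: rr_density_def)

lemma sets_rr [simp]: "sets (rr a b u v z) = Pow {u, v}" and space_rr [simp]: "space (rr a b u v z) = {u, v}"
  by (simp_all add: rr_def)

lemma emeasure_rr:
  assumes "0 \<le> a" "0 \<le> b" "0 < a + b" "S \<subseteq> {u, v}"
  shows "emeasure (rr a b u v z) S = ennreal (\<Sum>y\<in>S. rr_density a b u z y)"
proof -
  have "emeasure (rr a b u v z) S = (\<integral>\<^sup>+y. ennreal (rr_density a b u z y) * indicator S y \<partial>count_space {u, v})"
    unfolding rr_def using assms by (subst emeasure_density) auto
  also have "\<dots> = (\<Sum>y\<in>{u, v}. ennreal (rr_density a b u z y) * indicator S y)"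
    by (rule nn_integral_count_space_finite) simp
  also have "\<dots> = (\<Sum>y\<in>S. ennreal (rr_density a b u z y) * indicator S y)"
    using assms(4) by (intro sum.mono_neutral_right) auto
  also have "\<dots> = (\<Sum>y\<in>S. ennreal (rr_density a b u z y))"
    by (intro sum.cong) auto
  also have "\<dots> = ennreal (\<Sum>y\<in>S. rr_density a b u z y)"
    by (intro sum_ennreal rr_density_nonneg[OF assms(1-3)])
  finally show ?thesis .
qed

lemma measure_rr:
  assumes "0 \<le> a" "0 \<le> b" "0 < a + b" "S \<subseteq> {u, v}"
  shows "measure (rr a b u v z) S = (\<Sum>y\<in>S. rr_density a b u z y)"
  unfolding measure_def emeasure_rr[OF assms]
  by (simp add: sum_nonneg rr_density_nonneg[OF assms(1-3)])

lemma rr_in_prob_algebra: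
  assumes "0 \<le> a" "0 \<le> b" "0 < a + b" "u \<noteq> v"
  shows "rr a b u v z \<in> space (prob_algebra (count_space {u, v}))"
proof -
  have "(\<Sum>y\<in>{u, v}. rr_density a b u z y) = 1"
    using q_inverse_mean[OF assms(3)] assms(4) by (simp add: rr_density_def)
  then have "emeasure (rr a b u v z) (space (rr a b u v z)) = 1"
    by (simp only: emeasure_rr[OF assms(1-3), of "{u, v}", OF order_refl] space_rr) simp
  then show ?thesis by (auto simp: space_prob_algebra intro!: prob_spaceI)
qed

lemma integral_rr:
  assumes "0 \<le> a" "0 \<le> b" "0 < a + b" "u \<noteq> v"
  shows "(\<integral>y. g y \<partial>rr a b u v z) = rr_density a b u z u * g u + rr_density a b u z v * (g v :: real)"
proof -
  have "(\<integral>y. g y \<partial>rr a b u v z) = (\<integral>y. rr_density a b u z y * g y \<partial>count_space {u, v})"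
    unfolding rr_def using rr_density_nonneg[OF assms(1-3)] by (subst integral_density) (auto simp: AE_count_space)
  then show ?thesis using assms(4) by (simp add: lebesgue_integral_count_space_finite)
qed

text \<open>The equality case of \<open>randomized_response_bound\<close>: only the two extreme
  ratios occur.\<close>

lemma rr_hockey_stick:
  assumes "0 \<le> a" "0 \<le> b" "0 < a + b" "u \<noteq> v"
  shows "(\<integral>y. g y \<partial>rr a b u v True) - exp c * (\<integral>y. h y \<partial>rr a b u v False)
     = q (a + b) a * (g u - exp (c - a) * h u) + (1 - q (a + b) a) * (g v - exp (c + b) * (h v :: real))"
  using assms(4) by (simp add: integral_rr[OF assms] rr_density_def exp_diff exp_add exp_minus field_simps)

text \<open>\<open>x0\<close> receives one law and all other inputs the other, so it suffices to
  compare point masses for arbitrary flags \<open>z\<close> and \<open>z'\<close>.\<close>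

lemma rr_in_DP_class:
  assumes "0 < \<epsilon>" "u \<noteq> v"
  shows "(count_space {u, v}, \<lambda>x. rr \<epsilon> \<epsilon> u v (x = x0)) \<in> DP_class nb \<epsilon>"
proof -
  have e: "0 \<le> \<epsilon>" "0 \<le> \<epsilon>" "0 < \<epsilon> + \<epsilon>" using assms by auto
  note q = q_bounds[OF e]
  have le1: "exp (- \<epsilon>) \<le> 1" "1 \<le> exp \<epsilon>" using e by auto
  have le2: "exp (- \<epsilon>) \<le> exp \<epsilon>" using e by auto
  have le: "1 \<le> exp \<epsilon> * exp \<epsilon>" using le1(2) by (metis mult_mono' mult_1 zero_le_one)
  have "rr_density \<epsilon> \<epsilon> u z y \<le> exp \<epsilon> * rr_density \<epsilon> \<epsilon> u z' y" for z z' y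
  proof -
    have "k * r \<le> exp \<epsilon> * (k' * r)" if "k \<in> {exp (- \<epsilon>), 1}" "k' \<in> {exp (- \<epsilon>), 1}" "0 \<le> r" for k k' r :: real
    proof -
      have "k \<le> exp \<epsilon> * k'" using that le1 le2 by (auto simp flip: exp_add)
      then have "k * r \<le> exp \<epsilon> * k' * r" using that by (intro mult_right_mono)
      then show ?thesis by (simp add: mult.assoc)
    qed
    moreover have "k * r \<le> exp \<epsilon> * (k' * r)" if "k \<in> {exp \<epsilon>, 1}" "k' \<in> {exp \<epsilon>, 1}" "0 \<le> r" for k k' r :: real
    proof -
      have "k \<le> exp \<epsilon> * k'" using that le1 le by auto
      then have "k * r \<le> exp \<epsilon> * k' * r" using that by (intro mult_right_mono)
      then show ?thesis by (simp add: mult.assoc)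
    qed
    ultimately show ?thesis using q by (simp add: rr_density_def)
  qed
  then have "measure (rr \<epsilon> \<epsilon> u v z) S \<le> exp \<epsilon> * measure (rr \<epsilon> \<epsilon> u v z') S" if "S \<subseteq> {u, v}" for S z z'
    unfolding measure_rr[OF e that] sum_distrib_left by (rule sum_mono)
  then show ?thesis
    using rr_in_prob_algebra[OF e assms(2)] by (simp add: DP_class_def is_mechanism_def is_DP_def)
qed

lemma rr_in_BR_class:
  assumes "0 < \<epsilon>" "0 \<le> t" "t \<le> \<epsilon>" "u \<noteq> v"
  shows "(count_space {u, v}, \<lambda>x. rr t (\<epsilon> - t) u v (x = x0)) \<in> BR_class nb \<epsilon>"
proof -
  have e: "0 \<le> t" "0 \<le> \<epsilon> - t" "0 < t + (\<epsilon> - t)" using assms by auto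
  note q = q_bounds[OF e]
  define w where "w = q (t + (\<epsilon> - t)) t"
  have w: "0 \<le> w" "w \<le> 1" using q by (simp_all add: w_def)
  have scale: "k * p \<le> exp \<epsilon> * (k' * p)" if "k \<le> exp \<epsilon> * k'" "0 \<le> p" for k k' p :: real
    using mult_right_mono[OF that] by (simp add: mult.assoc)
  have dens: "rr_density t (\<epsilon> - t) u z y1 * rr_density t (\<epsilon> - t) u z' y2
      \<le> exp \<epsilon> * (rr_density t (\<epsilon> - t) u z y2 * rr_density t (\<epsilon> - t) u z' y1)" for z z' y1 y2
  proof -
    \<comment> \<open>Each density is an input-dependent factor \<open>k\<close> times a weight
      \<open>p\<close> common to both inputs. The ratios of \<open>k\<close> are
      \<open>exp t\<close> at \<open>u\<close> and \<open>exp (t - \<epsilon>)\<close> elsewhere, a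
      spread of exactly \<open>exp \<epsilon>\<close>.\<close>
    define k where "k = (\<lambda>z y. if y = u then (if z then 1 else exp (- t)) else (if z then 1 else exp (\<epsilon> - t)))"
    define p where "p = (\<lambda>y. if y = u then w else 1 - w)"
    have r: "rr_density t (\<epsilon> - t) u z y = k z y * p y" for z y
      by (simp add: rr_density_def k_def p_def w_def)
    have "k z y1 * k z' y2 \<le> exp \<epsilon> * (k z y2 * k z' y1)"
      using assms by (auto simp: k_def simp flip: exp_add)
    moreover have "0 \<le> p y1 * p y2" using w by (simp add: p_def)
    ultimately have "k z y1 * k z' y2 * (p y1 * p y2) \<le> exp \<epsilon> * (k z y2 * k z' y1 * (p y1 * p y2))"
      by (rule scale)
    then show ?thesis unfolding r by (simp add: mult_ac)
  qed
  have "is_BR nb \<epsilon> (count_space {u, v}, \<lambda>x. rr t (\<epsilon> - t) u v (x = x0))"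
    unfolding is_BR_def prod.case
  proof (intro allI impI)
    fix x x'
    show "\<exists>\<mu> f f'. f \<in> borel_measurable \<mu> \<and> f' \<in> borel_measurable \<mu> \<and>
        (\<forall>y\<in>space \<mu>. 0 \<le> f y \<and> 0 \<le> f' y) \<and>
        rr t (\<epsilon> - t) u v (x = x0) = density \<mu> (\<lambda>y. ennreal (f y)) \<and>
        rr t (\<epsilon> - t) u v (x' = x0) = density \<mu> (\<lambda>y. ennreal (f' y)) \<and>
        (\<forall>y1\<in>space \<mu>. \<forall>y2\<in>space \<mu>. f y1 * f' y2 \<le> exp \<epsilon> * (f y2 * f' y1))"
      by (intro exI[of _ "count_space {u, v}"] exI[of _ "rr_density t (\<epsilon> - t) u (x = x0)"]
          exI[of _ "rr_density t (\<epsilon> - t) u (x' = x0)"] conjI ballI dens)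
         (auto simp: rr_def rr_density_nonneg[OF e])
  qed
  then show ?thesis
    using rr_in_prob_algebra[OF e assms(4)] by (simp add: BR_class_def is_mechanism_def)
qed

section \<open>Sharpness of the bound by nested randomized responses\<close>

definition rr_rich :: "('x \<Rightarrow> 'x \<Rightarrow> bool) \<Rightarrow> (real \<times> real) set \<Rightarrow> ('x, 'y) mechanism set \<Rightarrow> bool" where
  "rr_rich nb R C \<longleftrightarrow> (\<forall>a b u v x0. (a, b) \<in> R \<longrightarrow> u \<noteq> v \<longrightarrow>
     (count_space {u, v}, \<lambda>x. rr a b u v (x = x0)) \<in> C)"

text \<open>Nested two-point mechanisms turn every estimate of the upper bound into an equality. The
  second step chooses its parameters by the first outcome (\<open>a' True\<close> after
  \<open>u1\<close>), the third its \<open>t\<close> by both outcomes.\<close>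

lemma composition_lower_bound:
  fixes C1 :: "('x, 'a) mechanism set" and C2 :: "('x, 'b) mechanism set"
  assumes "two_elements TYPE('a)" and "two_elements TYPE('b)" and "two_elements TYPE('c)"
    and eps: "0 < \<epsilon>" and x: "x \<noteq> x'"
    and R1: "likelihood_class nb R1 C1" "rr_rich nb R1 C1" and R2: "likelihood_class nb R2 C2" "rr_rich nb R2 C2"
    and ab: "(a, b) \<in> R1" and ab': "\<And>z. (a' z, b' z) \<in> R2"
  shows "\<exists>(N, M) \<in> (C1 \<triangleright> C2 \<triangleright> BR_class nb \<epsilon> :: ('x, ('a \<times> 'b) \<times> 'c) mechanism set).
     \<exists>S\<in>sets N. measure (M x) S - exp c * measure (M x') S =
       q (a + b) a * rr_mix (a' True) (b' True) (br_opt \<epsilon>) (c - a)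
        + (1 - q (a + b) a) * rr_mix (a' False) (b' False) (br_opt \<epsilon>) (c + b)"
proof -
  from assms(1-3) obtain u1 v1 :: 'a and u2 v2 :: 'b and u3 v3 :: 'c
    where uv: "u1 \<noteq> v1" "u2 \<noteq> v2" "u3 \<noteq> v3" unfolding two_elements_def by blast
  define N1 N2 N3 where "N1 = count_space {u1, v1}" and "N2 = count_space {u2, v2}" and "N3 = count_space {u3, v3}"
  have N12: "N1 \<Otimes>\<^sub>M N2 = count_space ({u1, v1} \<times> {u2, v2})"
    unfolding N1_def N2_def by (rule pair_measure_countable) auto
  have N123: "(N1 \<Otimes>\<^sub>M N2) \<Otimes>\<^sub>M N3 = count_space (({u1, v1} \<times> {u2, v2}) \<times> {u3, v3})"
    unfolding N12 N3_def by (rule pair_measure_countable) auto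
  \<comment> \<open>\<open>c1\<close> and \<open>c2\<close> are the budgets left after one and two
    outcomes, that is \<open>c\<close> minus the realized log-ratios.\<close>
  define c1 where "c1 = (\<lambda>y. if y = u1 then c - a else c + b)"
  define c2 where "c2 = (\<lambda>(y1, y2). if y2 = u2 then c1 y1 - a' (y1 = u1) else c1 y1 + b' (y1 = u1))"
  define t where "t = (\<lambda>y. br_arg \<epsilon> (c2 y))"
  define M1 where "M1 = (\<lambda>z. rr a b u1 v1 (z = x))"
  define M2 where "M2 = (\<lambda>z y. rr (a' (y = u1)) (b' (y = u1)) u2 v2 (z = x))"
  define M3 where "M3 = (\<lambda>z y. rr (t y) (\<epsilon> - t y) u3 v3 (z = x))"
  \<comment> \<open>The Neyman-Pearson event: the total log-ratio exceeds \<open>c\<close>, so the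
    final budget is negative.\<close>
  define S where "S = {(y, y3). y \<in> {u1, v1} \<times> {u2, v2} \<and> y3 \<in> {u3, v3} \<and>
     (if y3 = u3 then c2 y - t y else c2 y + (\<epsilon> - t y)) < 0}"
  have tb: "0 \<le> t y" "t y \<le> \<epsilon>" for y using eps by (auto simp: t_def br_arg_def)
  have p1: "0 \<le> a" "0 \<le> b" "0 < a + b" using R1(1) ab by (auto simp: likelihood_class_def)
  have p2: "0 \<le> a' z" "0 \<le> b' z" "0 < a' z + b' z" for z using R2(1) ab'[of z] by (auto simp: likelihood_class_def)
  have p3: "0 \<le> t y" "0 \<le> \<epsilon> - t y" "0 < t y + (\<epsilon> - t y)" for y using tb[of y] eps by auto
  have M1: "(N1, M1) \<in> C1" using R1(2) ab uv by (auto simp: rr_rich_def N1_def M1_def)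
  have M2: "(N2, \<lambda>z. M2 z y) \<in> C2" for y
    using R2(2) ab'[of "y = u1"] uv by (auto simp: rr_rich_def N2_def M2_def)
  have M3: "(N3, \<lambda>z. M3 z y) \<in> BR_class nb \<epsilon>" for y
    unfolding N3_def M3_def by (rule rr_in_BR_class[OF eps tb uv(3)])
  have q1: "M1 z \<in> space (prob_algebra N1)" for z
    unfolding M1_def N1_def by (rule rr_in_prob_algebra[OF p1 uv(1)])
  have k2: "M2 z \<in> N1 \<rightarrow>\<^sub>M prob_algebra N2" for z
    unfolding N1_def measurable_count_space_eq1 M2_def N2_def
    using rr_in_prob_algebra[OF p2 uv(2)] by auto
  have k3: "M3 z \<in> N1 \<Otimes>\<^sub>M N2 \<rightarrow>\<^sub>M prob_algebra N3" for z
    unfolding N12 measurable_count_space_eq1 M3_def N3_def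
    using rr_in_prob_algebra[OF p3 uv(3)] by auto
  define M where "M = (\<lambda>z. kernel_pair (N1 \<Otimes>\<^sub>M N2) N3 (kernel_pair N1 N2 (M1 z) (M2 z)) (M3 z))"
  have mem: "((N1 \<Otimes>\<^sub>M N2) \<Otimes>\<^sub>M N3, M) \<in> C1 \<triangleright> C2 \<triangleright> BR_class nb \<epsilon>"
    unfolding M_def by (intro adaptive_compI M1 M2 M3 k2 k3)
  have S: "S \<in> sets ((N1 \<Otimes>\<^sub>M N2) \<Otimes>\<^sub>M N3)"
    unfolding N123 by (auto simp: S_def)
  define g3 where "g3 = (\<lambda>z y. \<integral>y3. indicator S (y, y3) \<partial>M3 z y :: real)"
  define g2 where "g2 = (\<lambda>z y1. \<integral>y2. g3 z (y1, y2) \<partial>M2 z y1)"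
  have eq: "measure (M z) S = (\<integral>y. g2 z y \<partial>M1 z)" for z
    unfolding M_def g2_def g3_def by (rule measure_kernel_pair[OF q1 k2 k3 S])
  have x'x: "(x' = x) = False" using x by simp
  have e3: "g3 x y - exp (c2 y) * g3 x' y = br_opt \<epsilon> (c2 y)" if y: "y \<in> {u1, v1} \<times> {u2, v2}" for y
  proof -
    \<comment> \<open>Acceptance pays \<open>1 - exp c'\<close>, which is positive exactly when
      \<open>c' < 0\<close>; hence \<open>S\<close> realizes the positive part.\<close>
    have ind: "indicator S (y, y3) - exp c' * indicator S (y, y3) = max 0 (1 - exp c')"
      if "y3 \<in> {u3, v3}" "c' = (if y3 = u3 then c2 y - t y else c2 y + (\<epsilon> - t y))" for y3 and c' :: real
      using that y by (auto simp: S_def indicator_def)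
    have "g3 x y - exp (c2 y) * g3 x' y = rr_mix (t y) (\<epsilon> - t y) (\<lambda>c. max 0 (1 - exp c)) (c2 y)"
      unfolding g3_def M3_def x'x rr_mix_def simp_thms
      by (subst rr_hockey_stick[OF p3 uv(3)])
         (use uv(3) ind[of u3 "c2 y - t y"] ind[of v3 "c2 y + (\<epsilon> - t y)"] in simp)
    also have "\<dots> = br_opt \<epsilon> (c2 y)" unfolding t_def by (rule rr_mix_br_arg[OF eps])
    finally show ?thesis .
  qed
  have e2: "g2 x y - exp (c1 y) * g2 x' y = rr_mix (a' (y = u1)) (b' (y = u1)) (br_opt \<epsilon>) (c1 y)"
    if y: "y \<in> {u1, v1}" for y
    unfolding g2_def M2_def x'x rr_mix_def simp_thms
    by (subst rr_hockey_stick[OF p2 uv(2)])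
       (use uv(2) y e3[of "(y, u2)"] e3[of "(y, v2)"] in \<open>simp add: c2_def\<close>)
  have "measure (M x) S - exp c * measure (M x') S =
       q (a + b) a * rr_mix (a' True) (b' True) (br_opt \<epsilon>) (c - a)
        + (1 - q (a + b) a) * rr_mix (a' False) (b' False) (br_opt \<epsilon>) (c + b)"
    unfolding eq M1_def x'x simp_thms
    by (subst rr_hockey_stick[OF p1 uv(1)])
       (use uv(1) e2[of u1] e2[of v1] in \<open>simp add: c1_def\<close>)
  then show ?thesis using mem S by blast
qed

text \<open>The supremum is attained: \<open>V\<close> bounds the excess of every member on every
  event, and one member has an event of excess exactly \<open>V\<close>.\<close>

lemma delta_opt_class_comp_eq:
  fixes C1 :: "('x, 'a) mechanism set" and C2 :: "('x, 'b) mechanism set"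
  assumes "two_elements TYPE('a)" and "two_elements TYPE('b)" and "two_elements TYPE('c)"
    and eps: "0 < \<epsilon>" and x: "x \<noteq> x'" "nb x x'"
    and R1: "likelihood_class nb R1 C1" "rr_rich nb R1 C1" and R2: "likelihood_class nb R2 C2" "rr_rich nb R2 C2"
    and ab: "(a, b) \<in> R1" and ab': "\<And>z. (a' z, b' z) \<in> R2"
    and V: "V = q (a + b) a * rr_mix (a' True) (b' True) (br_opt \<epsilon>) (c - a)
        + (1 - q (a + b) a) * rr_mix (a' False) (b' False) (br_opt \<epsilon>) (c + b)"
    and ub: "\<And>a b. (a, b) \<in> R1 \<Longrightarrow> \<exists>Ka Kb.
      (\<forall>a' b'. (a', b') \<in> R2 \<longrightarrow> rr_mix a' b' (br_opt \<epsilon>) (c - a) \<le> Ka \<and> rr_mix a' b' (br_opt \<epsilon>) (c + b) \<le> Kb) \<and>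
      q (a + b) a * Ka + (1 - q (a + b) a) * Kb \<le> V"
  shows "delta_opt_class nb (C1 \<triangleright> C2 \<triangleright> BR_class nb \<epsilon> :: ('x, ('a \<times> 'b) \<times> 'c) mechanism set) c = V"
proof -
  let ?C = "C1 \<triangleright> C2 \<triangleright> BR_class nb \<epsilon> :: ('x, ('a \<times> 'b) \<times> 'c) mechanism set"
  have up: "measure (M z) S - exp c * measure (M z') S \<le> V"
    if "(N, M) \<in> ?C" "nb z z'" "S \<in> sets N" for N M z z' S
    by (rule composition_upper_bound[OF that(1,2) eps R1(1) R2(1) ub that(3)])
  obtain N M S where m: "(N, M) \<in> ?C" and S: "S \<in> sets N"
    and eq: "measure (M x) S - exp c * measure (M x') S = V"
    using composition_lower_bound[OF assms(1-3) eps x(1) R1 R2 ab, of a' b' c] ab' unfolding V by blast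
  \<comment> \<open>The empty event shows that \<open>V\<close> is nonnegative, hence itself an
    admissible \<delta>.\<close>
  have V0: "0 \<le> V" using up[OF m x(2), of "{}"] by simp
  have V_in: "V \<in> {\<delta>. 0 \<le> \<delta> \<and> is_DP nb c \<delta> m'}" if "m' \<in> ?C" for m'
    using V0 up that by (cases m') (force simp: is_DP_def algebra_simps)
  have bdd: "bdd_below {\<delta>. 0 \<le> \<delta> \<and> is_DP nb c \<delta> m'}" for m' :: "('x, ('a \<times> 'b) \<times> 'c) mechanism"
    by (intro bdd_belowI[of _ 0]) auto
  have le: "delta_opt nb m' c \<le> V" if "m' \<in> ?C" for m'
    unfolding delta_opt_def by (rule cInf_lower[OF V_in[OF that] bdd])
  have "V \<le> \<delta>" if "is_DP nb c \<delta> (N, M)" for \<delta>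
  proof -
    have "measure (M x) S \<le> exp c * measure (M x') S + \<delta>"
      using that x(2) S unfolding is_DP_def by blast
    then show ?thesis using eq by simp
  qed
  then have "V \<le> delta_opt nb (N, M) c"
    unfolding delta_opt_def using V_in[OF m] by (intro cInf_greatest) auto
  then have "delta_opt nb (N, M) c = V" using le[OF m] by simp
  then show ?thesis
    unfolding delta_opt_class_def using m le
    by (intro cSup_eq_maximum) (auto intro!: image_eqI[of _ _ "(N, M)"])
qed

subsection \<open>Maximization over the range parameter\<close>

text \<open>The part of \<open>y_fun\<close> varying with \<open>u = exp (t / 2)\<close>. The
  factors vanish at \<open>E u^3 = G\<close> and \<open>E u = G\<close>, that is at
  \<open>t = (\<epsilon> + \<epsilon>g) / 3\<close> and
  \<open>t = \<epsilon> + \<epsilon>g\<close>.\<close>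

lemma DERIV_y_profile:
  fixes u E G :: real
  assumes "0 < u"
  shows "((\<lambda>u. E\<^sup>2 * u\<^sup>2 - 2 * G * E * u + 2 * G * E / u - G\<^sup>2 / u\<^sup>2) has_real_derivative
    2 / u ^ 3 * ((E * u ^ 3 - G) * (E * u - G))) (at u)"
proof -
  have "((\<lambda>u. E\<^sup>2 * u\<^sup>2 - 2 * G * E * u + 2 * G * E / u - G\<^sup>2 / u\<^sup>2) has_real_derivative
    E\<^sup>2 * (2 * u) - 2 * G * E - 2 * G * E / u\<^sup>2 + G\<^sup>2 * (2 * u) / (u\<^sup>2 * u\<^sup>2)) (at u)"
    using assms by (auto intro!: derivative_eq_intros simp: power2_eq_square)
  also have "E\<^sup>2 * (2 * u) - 2 * G * E - 2 * G * E / u\<^sup>2 + G\<^sup>2 * (2 * u) / (u\<^sup>2 * u\<^sup>2)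
     = 2 / u ^ 3 * ((E * u ^ 3 - G) * (E * u - G))"
    using assms by (simp add: field_simps) (simp add: algebra_simps eval_nat_numeral)
  finally show ?thesis .
qed

text \<open>The part of \<open>z_fun\<close> varying with \<open>u\<close>; the factors vanish at
  \<open>t = \<epsilon>g\<close> and \<open>t = (2 * \<epsilon> + \<epsilon>g) / 3\<close>.\<close>

lemma DERIV_z_profile:
  fixes u E G :: real
  assumes "0 < u"
  shows "((\<lambda>u. (1 - u\<^sup>2 * E\<^sup>2) * (1 - G / u)\<^sup>2) has_real_derivative
    2 / u ^ 3 * ((u - G) * (G - E\<^sup>2 * u ^ 3))) (at u)"
proof -
  have "((\<lambda>u. (1 - u\<^sup>2 * E\<^sup>2) * (1 - G / u)\<^sup>2) has_real_derivative
    - (2 * u * E\<^sup>2) * (1 - G / u)\<^sup>2 + (1 - u\<^sup>2 * E\<^sup>2) * (2 * (1 - G / u) * (G / u\<^sup>2))) (at u)"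
    using assms by (auto intro!: derivative_eq_intros simp: power2_eq_square)
  also have "- (2 * u * E\<^sup>2) * (1 - G / u)\<^sup>2 + (1 - u\<^sup>2 * E\<^sup>2) * (2 * (1 - G / u) * (G / u\<^sup>2))
     = 2 / u ^ 3 * ((u - G) * (G - E\<^sup>2 * u ^ 3))"
    using assms by (simp add: field_simps) (simp add: algebra_simps eval_nat_numeral)
  finally show ?thesis .
qed

lemma exp_thirds: "exp (x / 2) ^ 3 = exp (3 * x / 2 :: real)"
  by (simp flip: exp_of_nat_mult)

section \<open>Rational form of x, y and z, and the maximum of x\<close>

locale composition_params =
  fixes \<epsilon> \<epsilon>g :: real
  assumes eps: "0 < \<epsilon>" and g0: "0 \<le> \<epsilon>g" and ge: "\<epsilon>g < \<epsilon>"
begin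

text \<open>In the variable \<open>u = exp (t / 2)\<close> the three functions become rational, with coefficients in \<open>E\<close> and \<open>G\<close>.\<close>

definition E where "E = exp (- \<epsilon> / 2)"
definition G where "G = exp (\<epsilon>g / 2)"
text \<open>Common denominator of the three functions; the factor \<open>1 + E^2\<close> comes from
  \<open>q (2 * \<epsilon>) \<epsilon>\<close>.\<close>

definition D where "D = (1 + E\<^sup>2) * (1 - E\<^sup>2)\<^sup>2"

lemma E_bounds: "0 < E" "E < 1" and G_pos: "0 < G"
  using eps by (simp_all add: E_def G_def)

lemma E2_less_1: "E\<^sup>2 < 1" using E_bounds by (simp add: power_less_one_iff)

lemma D_pos: "0 < D"
  using E2_less_1 E_bounds by (simp add: D_def add_pos_pos)

lemma exp_neg_eps: "exp (- \<epsilon>) = E\<^sup>2" "exp (- (2 * \<epsilon>)) = E\<^sup>2 * E\<^sup>2"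
  by (simp_all add: E_def power2_eq_square flip: exp_add)

lemma q_eq:
  "q \<epsilon> t = (1 - exp (t / 2) ^ 2 * E\<^sup>2) / (1 - E\<^sup>2)"
  "q \<epsilon> ((\<epsilon>g - t) / 2) = (1 - G * E\<^sup>2 / exp (t / 2)) / (1 - E\<^sup>2)"
  "q \<epsilon> ((\<epsilon>g + \<epsilon> - t) / 2) = (1 - G * E / exp (t / 2)) / (1 - E\<^sup>2)"
  "q \<epsilon> (\<epsilon> + (\<epsilon>g - t) / 2) = (1 - G / exp (t / 2)) / (1 - E\<^sup>2)"
  "exp (\<epsilon>g - \<epsilon> - t) = G\<^sup>2 * E\<^sup>2 / exp (t / 2) ^ 2"
proof -
  have "exp (t - \<epsilon>) = exp (t / 2) ^ 2 * E\<^sup>2"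
    "exp ((\<epsilon>g - t) / 2 - \<epsilon>) = G * E\<^sup>2 / exp (t / 2)"
    "exp ((\<epsilon>g + \<epsilon> - t) / 2 - \<epsilon>) = G * E / exp (t / 2)"
    "exp ((\<epsilon>g - t) / 2) = G / exp (t / 2)"
    by (simp_all add: E_def G_def power2_eq_square field_simps flip: exp_add exp_diff)
  then show "q \<epsilon> t = (1 - exp (t / 2) ^ 2 * E\<^sup>2) / (1 - E\<^sup>2)"
    "q \<epsilon> ((\<epsilon>g - t) / 2) = (1 - G * E\<^sup>2 / exp (t / 2)) / (1 - E\<^sup>2)"
    "q \<epsilon> ((\<epsilon>g + \<epsilon> - t) / 2) = (1 - G * E / exp (t / 2)) / (1 - E\<^sup>2)"
    "q \<epsilon> (\<epsilon> + (\<epsilon>g - t) / 2) = (1 - G / exp (t / 2)) / (1 - E\<^sup>2)"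
    by (simp_all add: q_def exp_neg_eps)
  show "exp (\<epsilon>g - \<epsilon> - t) = G\<^sup>2 * E\<^sup>2 / exp (t / 2) ^ 2"
    by (simp add: E_def G_def power2_eq_square flip: exp_add exp_diff)
qed

lemma q_DP: "q (2 * \<epsilon>) \<epsilon> = 1 / (1 + E\<^sup>2)" "1 - q (2 * \<epsilon>) \<epsilon> = E\<^sup>2 / (1 + E\<^sup>2)"
proof -
  have p: "1 + E\<^sup>2 \<noteq> 0" "1 - E\<^sup>2 \<noteq> 0"
    using E2_less_1 zero_le_power2[of E] by (linarith, simp)
  have "1 - E\<^sup>2 * E\<^sup>2 = (1 + E\<^sup>2) * (1 - E\<^sup>2)" by (simp add: algebra_simps)
  then show 1: "q (2 * \<epsilon>) \<epsilon> = 1 / (1 + E\<^sup>2)" using p by (simp add: q_def exp_neg_eps)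
  show "1 - q (2 * \<epsilon>) \<epsilon> = E\<^sup>2 / (1 + E\<^sup>2)" unfolding 1 using p by (simp add: field_simps)
qed

lemma xyz_eq:
  assumes u: "u = exp (t / 2)"
  shows "x_fun \<epsilon> \<epsilon>g t = (1 - E\<^sup>2 + G\<^sup>2 * E ^ 4 - G\<^sup>2 * E ^ 6 - 2 * G * E\<^sup>2 * (1 - E) * (E * u + 1 / u)) / D"
    "y_fun \<epsilon> \<epsilon>g t = (1 - 2 * E\<^sup>2 + 2 * G\<^sup>2 * E ^ 4 - G\<^sup>2 * E ^ 6
       + E\<^sup>2 * (E\<^sup>2 * u\<^sup>2 - 2 * G * E * u + 2 * G * E / u - G\<^sup>2 / u\<^sup>2)) / D"
    "z_fun \<epsilon> \<epsilon>g t = E\<^sup>2 * ((1 - u\<^sup>2 * E\<^sup>2) * (1 - G / u)\<^sup>2) / D"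
proof -
  have p: "1 + E\<^sup>2 \<noteq> 0" "1 - E\<^sup>2 \<noteq> 0"
    using E2_less_1 zero_le_power2[of E] by (linarith, simp)
  \<comment> \<open>With \<open>w\<close> for \<open>1 / u\<close> the numerators of x and y become
    polynomial identities modulo \<open>u * w = 1\<close>.\<close>
  define w where "w = 1 / u"
  have uw: "u * w = 1" by (simp add: w_def u)
  have div: "a / u = a * w" "a / u\<^sup>2 = a * w\<^sup>2" for a by (simp_all add: w_def power_divide)
  note q_u = q_eq(1)[of t] q_eq(2-5)[of t] q_DP u[symmetric] exp_neg_eps D_def
  have 1: "1 - (1 - u\<^sup>2 * E\<^sup>2) / (1 - E\<^sup>2) = (u\<^sup>2 - 1) * E\<^sup>2 / (1 - E\<^sup>2)"
    using p by (simp add: field_simps)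
  have "1 / r * (a / s * (b / s)\<^sup>2 * s + c / s * (d / s)\<^sup>2 * s) = (a * b\<^sup>2 + c * d\<^sup>2) / (r * s\<^sup>2)"
    if "r \<noteq> 0" "s \<noteq> 0" for a b c d r s :: real
    using that by (simp add: field_simps power2_eq_square)
  note x = this[OF p]
  have "1 / r * (a / s * b + c / s * (d / s)\<^sup>2 * s) = (s * a * b + c * d\<^sup>2) / (r * s\<^sup>2)"
    if "r \<noteq> 0" "s \<noteq> 0" for a b c d r s :: real
    using that by (simp add: field_simps power2_eq_square)
  note y = this[OF p]
  have "e / r * (a / s) * (b / s)\<^sup>2 * s = e * (a * b\<^sup>2) / (r * s\<^sup>2)"
    if "r \<noteq> 0" "s \<noteq> 0" for a b e r s :: real
    using that by (simp add: field_simps power2_eq_square)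
  note z = this[OF p]
  show "x_fun \<epsilon> \<epsilon>g t = (1 - E\<^sup>2 + G\<^sup>2 * E ^ 4 - G\<^sup>2 * E ^ 6 - 2 * G * E\<^sup>2 * (1 - E) * (E * u + 1 / u)) / D"
    unfolding x_fun_def q_u 1 x unfolding div using uw by (intro arg_cong2[where f = "(/)"]) (algebra | simp)+
  show "y_fun \<epsilon> \<epsilon>g t = (1 - 2 * E\<^sup>2 + 2 * G\<^sup>2 * E ^ 4 - G\<^sup>2 * E ^ 6
       + E\<^sup>2 * (E\<^sup>2 * u\<^sup>2 - 2 * G * E * u + 2 * G * E / u - G\<^sup>2 / u\<^sup>2)) / D"
    unfolding y_fun_def q_u 1 y unfolding div using uw by (intro arg_cong2[where f = "(/)"]) (algebra | simp)+
  show "z_fun \<epsilon> \<epsilon>g t = E\<^sup>2 * ((1 - u\<^sup>2 * E\<^sup>2) * (1 - G / u)\<^sup>2) / D"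
    unfolding z_fun_def q_DP(2) unfolding q_u z ..
qed

text \<open>For a \<open>t\<close> shared by both DP outcomes, the branch values add up to y + z
  when \<open>t \<ge> \<epsilon>g\<close> and to x below; this identity merges the two
  cases.\<close>

lemma x_eq_y_plus_z: "x_fun \<epsilon> \<epsilon>g t = y_fun \<epsilon> \<epsilon>g t + z_fun \<epsilon> \<epsilon>g t"
proof -
  define u w where "u = exp (t / 2)" and "w = 1 / u"
  have uw: "u * w = 1" by (simp add: w_def u_def)
  have div: "a / u = a * w" "a / u\<^sup>2 = a * w\<^sup>2" for a by (simp_all add: w_def power_divide)
  show ?thesis
    unfolding xyz_eq[OF u_def] add_divide_distrib[symmetric] unfolding div
    using uw by (intro arg_cong2[where f = "(/)"]) (algebra | simp)+
qed

text \<open>\<open>x_fun\<close> falls as \<open>E u + 1 / u\<close> grows, an expression invariant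
  under exchanging \<open>t\<close> with \<open>\<epsilon> - t\<close> and least at
  \<open>\<epsilon> / 2\<close>. The assumption says that \<open>s\<close> lies between
  \<open>t\<close> and \<open>\<epsilon> - t\<close>.\<close>

lemma x_mono:
  assumes "0 \<le> (s - t) * (\<epsilon> - t - s)"
  shows "x_fun \<epsilon> \<epsilon>g t \<le> x_fun \<epsilon> \<epsilon>g s"
proof -
  define u v where "u = exp (t / 2)" "v = exp (s / 2)"
  have p: "0 < u" "0 < v" by (simp_all add: u_v_def)
  have Euv: "E * u * v = exp ((t + s - \<epsilon>) / 2)"
    by (simp add: E_def u_v_def field_simps flip: exp_add)
  have "0 \<le> (v - u) * (1 - E * u * v)"
  proof (cases "t \<le> s")
    case True
    then have "s = t \<or> t + s \<le> \<epsilon>" using assms by (auto simp: zero_le_mult_iff)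
    then show ?thesis
    proof
      assume "t + s \<le> \<epsilon>"
      then show ?thesis unfolding Euv using True by (intro mult_nonneg_nonneg) (simp_all add: u_v_def)
    qed (simp add: u_v_def)
  next
    case False
    then have "\<epsilon> \<le> t + s" using assms by (auto simp: zero_le_mult_iff)
    then show ?thesis unfolding Euv using False by (intro mult_nonpos_nonpos) (simp_all add: u_v_def)
  qed
  then have "0 \<le> (v - u) * (1 - E * u * v) / (u * v)" using p by simp
  also have "\<dots> = (E * u + 1 / u) - (E * v + 1 / v)" using p by (simp add: field_simps)
  finally have le: "E * v + 1 / v \<le> E * u + 1 / u" by simp
  have "2 * G * E\<^sup>2 * (1 - E) * (E * v + 1 / v) \<le> 2 * G * E\<^sup>2 * (1 - E) * (E * u + 1 / u)"
    by (rule mult_left_mono[OF le]) (use E_bounds G_pos in simp)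
  then show ?thesis
    unfolding xyz_eq(1)[OF u_v_def(1)] xyz_eq(1)[OF u_v_def(2)]
    using D_pos by (intro divide_right_mono) auto
qed

lemma x_max: "x_fun \<epsilon> \<epsilon>g t \<le> x_fun \<epsilon> \<epsilon>g (\<epsilon> / 2)"
proof (rule x_mono)
  have "(\<epsilon> / 2 - t) * (\<epsilon> - t - \<epsilon> / 2) = (\<epsilon> / 2 - t) * (\<epsilon> / 2 - t)" by simp
  then show "0 \<le> (\<epsilon> / 2 - t) * (\<epsilon> - t - \<epsilon> / 2)" by simp
qed

section \<open>Monotonicity of y and z between the zeros of their derivatives\<close>

lemma exp_conditions:
  "E * exp (t / 2) ^ 3 \<le> G \<longleftrightarrow> t \<le> (\<epsilon> + \<epsilon>g) / 3" "G \<le> E * exp (t / 2) ^ 3 \<longleftrightarrow> (\<epsilon> + \<epsilon>g) / 3 \<le> t"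
  "E\<^sup>2 * exp (t / 2) ^ 3 \<le> G \<longleftrightarrow> t \<le> (2 * \<epsilon> + \<epsilon>g) / 3" "G \<le> E\<^sup>2 * exp (t / 2) ^ 3 \<longleftrightarrow> (2 * \<epsilon> + \<epsilon>g) / 3 \<le> t"
  "E * exp (t / 2) \<le> G \<longleftrightarrow> t \<le> \<epsilon> + \<epsilon>g" "G \<le> exp (t / 2) \<longleftrightarrow> \<epsilon>g \<le> t"
  unfolding exp_thirds by (auto simp: E_def G_def power2_eq_square simp flip: exp_add)

text \<open>Up to \<open>(\<epsilon> + \<epsilon>g) / 3\<close> both factors of the derivative are
  nonpositive.\<close>

lemma y_mono:
  assumes "t \<le> s" "s \<le> (\<epsilon> + \<epsilon>g) / 3"
  shows "y_fun \<epsilon> \<epsilon>g t \<le> y_fun \<epsilon> \<epsilon>g s"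
proof -
  define u v where "u = exp (t / 2)" "v = exp (s / 2)"
  have p: "0 < u" "u \<le> v" using assms by (simp_all add: u_v_def)
  have c: "E * v ^ 3 \<le> G" "E * v \<le> G"
    unfolding u_v_def exp_conditions using assms eps g0 by auto
  have "E\<^sup>2 * u\<^sup>2 - 2 * G * E * u + 2 * G * E / u - G\<^sup>2 / u\<^sup>2 \<le> E\<^sup>2 * v\<^sup>2 - 2 * G * E * v + 2 * G * E / v - G\<^sup>2 / v\<^sup>2"
  proof (rule DERIV_nonneg_imp_nondecreasing[OF p(2)])
    fix w assume w: "u \<le> w" "w \<le> v"
    have "E * w ^ 3 \<le> E * v ^ 3" "E * w \<le> E * v"
      using w p E_bounds by (auto intro!: mult_left_mono power_mono)
    then have "0 \<le> (E * w ^ 3 - G) * (E * w - G)" using c by (intro mult_nonpos_nonpos) auto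
    then have "0 \<le> 2 / w ^ 3 * ((E * w ^ 3 - G) * (E * w - G))"
      by (rule mult_nonneg_nonneg[rotated]) (use w p in simp)
    then show "\<exists>y. ((\<lambda>u. E\<^sup>2 * u\<^sup>2 - 2 * G * E * u + 2 * G * E / u - G\<^sup>2 / u\<^sup>2) has_real_derivative y) (at w) \<and> 0 \<le> y"
      using DERIV_y_profile[of w E G] less_le_trans[of 0 u w] w p by (meson less_imp_le)
  qed
  then show ?thesis
    unfolding xyz_eq(2)[OF u_v_def(1)] xyz_eq(2)[OF u_v_def(2)]
    using D_pos E_bounds by (intro divide_right_mono add_left_mono mult_left_mono) auto
qed

text \<open>Past \<open>(\<epsilon> + \<epsilon>g) / 3\<close> the first factor is nonnegative; the
  second stays nonpositive, as its zero \<open>\<epsilon> + \<epsilon>g\<close> is not below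
  \<open>\<epsilon>\<close>.\<close>

lemma y_antimono:
  assumes "(\<epsilon> + \<epsilon>g) / 3 \<le> t" "t \<le> s" "s \<le> \<epsilon>"
  shows "y_fun \<epsilon> \<epsilon>g s \<le> y_fun \<epsilon> \<epsilon>g t"
proof -
  define u v where "u = exp (t / 2)" "v = exp (s / 2)"
  have p: "0 < u" "u \<le> v" using assms by (simp_all add: u_v_def)
  have c: "G \<le> E * u ^ 3" "E * v \<le> G"
    unfolding u_v_def exp_conditions using assms eps g0 by auto
  have "E\<^sup>2 * v\<^sup>2 - 2 * G * E * v + 2 * G * E / v - G\<^sup>2 / v\<^sup>2 \<le> E\<^sup>2 * u\<^sup>2 - 2 * G * E * u + 2 * G * E / u - G\<^sup>2 / u\<^sup>2"
  proof (rule DERIV_nonpos_imp_nonincreasing[OF p(2)])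
    fix w assume w: "u \<le> w" "w \<le> v"
    have "E * u ^ 3 \<le> E * w ^ 3" "E * w \<le> E * v"
      using w p E_bounds by (auto intro!: mult_left_mono power_mono)
    then have "(E * w ^ 3 - G) * (E * w - G) \<le> 0" using c by (intro mult_nonneg_nonpos) auto
    then have "2 / w ^ 3 * ((E * w ^ 3 - G) * (E * w - G)) \<le> 0"
      by (rule mult_nonneg_nonpos[rotated]) (use w p in simp)
    then show "\<exists>y. ((\<lambda>u. E\<^sup>2 * u\<^sup>2 - 2 * G * E * u + 2 * G * E / u - G\<^sup>2 / u\<^sup>2) has_real_derivative y) (at w) \<and> y \<le> 0"
      using DERIV_y_profile[of w E G] less_le_trans[of 0 u w] w p by (meson less_imp_le)
  qed
  then show ?thesis
    unfolding xyz_eq(2)[OF u_v_def(1)] xyz_eq(2)[OF u_v_def(2)]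
    using D_pos E_bounds by (intro divide_right_mono add_left_mono mult_left_mono) auto
qed

text \<open>The derivative can vanish at the endpoints, so its positivity is used on the open
  interval together with continuity. The strictness here is what separates the two
  compositions.\<close>

lemma z_strict_mono:
  assumes "\<epsilon>g \<le> t" "t < s" "s \<le> (2 * \<epsilon> + \<epsilon>g) / 3"
  shows "z_fun \<epsilon> \<epsilon>g t < z_fun \<epsilon> \<epsilon>g s"
proof -
  define u v where "u = exp (t / 2)" "v = exp (s / 2)"
  have p: "0 < u" "u < v" using assms by (simp_all add: u_v_def)
  have c: "G \<le> u" "E\<^sup>2 * v ^ 3 \<le> G"
    unfolding u_v_def exp_conditions using assms eps g0 by auto
  have "(1 - u\<^sup>2 * E\<^sup>2) * (1 - G / u)\<^sup>2 < (1 - v\<^sup>2 * E\<^sup>2) * (1 - G / v)\<^sup>2"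
  proof (rule DERIV_pos_imp_increasing_open[OF p(2)])
    fix w assume w: "u < w" "w < v"
    have "E\<^sup>2 * w ^ 3 < E\<^sup>2 * v ^ 3"
      using w p E_bounds by (auto intro!: mult_strict_left_mono power_strict_mono)
    then have "0 < (w - G) * (G - E\<^sup>2 * w ^ 3)" using c w by (intro mult_pos_pos) auto
    then have "0 < 2 / w ^ 3 * ((w - G) * (G - E\<^sup>2 * w ^ 3))"
      by (rule mult_pos_pos[rotated]) (use w p in simp)
    then show "\<exists>y. ((\<lambda>u. (1 - u\<^sup>2 * E\<^sup>2) * (1 - G / u)\<^sup>2) has_real_derivative y) (at w) \<and> 0 < y"
      using DERIV_z_profile[of w E G] less_le_trans[of 0 u w] w p by (meson less_imp_le)
  next
    show "continuous_on {u..v} (\<lambda>u. (1 - u\<^sup>2 * E\<^sup>2) * (1 - G / u)\<^sup>2)"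
      using p by (intro continuous_intros) auto
  qed
  then show ?thesis
    unfolding xyz_eq(3)[OF u_v_def(1)] xyz_eq(3)[OF u_v_def(2)]
    using D_pos E_bounds by (intro divide_strict_right_mono mult_strict_left_mono) auto
qed

lemma z_antimono:
  assumes "(2 * \<epsilon> + \<epsilon>g) / 3 \<le> t" "t \<le> s"
  shows "z_fun \<epsilon> \<epsilon>g s \<le> z_fun \<epsilon> \<epsilon>g t"
proof -
  define u v where "u = exp (t / 2)" "v = exp (s / 2)"
  have p: "0 < u" "u \<le> v" using assms by (simp_all add: u_v_def)
  have c: "G \<le> u" "G \<le> E\<^sup>2 * u ^ 3"
    unfolding u_v_def exp_conditions using assms ge by auto
  have "(1 - v\<^sup>2 * E\<^sup>2) * (1 - G / v)\<^sup>2 \<le> (1 - u\<^sup>2 * E\<^sup>2) * (1 - G / u)\<^sup>2"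
  proof (rule DERIV_nonpos_imp_nonincreasing[OF p(2)])
    fix w assume w: "u \<le> w" "w \<le> v"
    have "E\<^sup>2 * u ^ 3 \<le> E\<^sup>2 * w ^ 3"
      using w p E_bounds by (auto intro!: mult_left_mono power_mono)
    then have "(w - G) * (G - E\<^sup>2 * w ^ 3) \<le> 0" using c w by (intro mult_nonneg_nonpos) auto
    then have "2 / w ^ 3 * ((w - G) * (G - E\<^sup>2 * w ^ 3)) \<le> 0"
      by (rule mult_nonneg_nonpos[rotated]) (use w p in simp)
    then show "\<exists>y. ((\<lambda>u. (1 - u\<^sup>2 * E\<^sup>2) * (1 - G / u)\<^sup>2) has_real_derivative y) (at w) \<and> y \<le> 0"
      using DERIV_z_profile[of w E G] less_le_trans[of 0 u w] w p by (meson less_imp_le)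
  qed
  then show ?thesis
    unfolding xyz_eq(3)[OF u_v_def(1)] xyz_eq(3)[OF u_v_def(2)]
    using D_pos E_bounds by (intro divide_right_mono mult_left_mono) auto
qed

lemma z_at_g: "z_fun \<epsilon> \<epsilon>g \<epsilon>g = 0"
  unfolding xyz_eq(3)[OF refl] by (simp add: G_def)

lemma z_max:
  assumes "\<epsilon>g \<le> t"
  shows "z_fun \<epsilon> \<epsilon>g t \<le> z_fun \<epsilon> \<epsilon>g ((2 * \<epsilon> + \<epsilon>g) / 3)"
  using z_strict_mono[of t "(2 * \<epsilon> + \<epsilon>g) / 3"] z_antimono[of "(2 * \<epsilon> + \<epsilon>g) / 3" t] assms
  by (cases "t < (2 * \<epsilon> + \<epsilon>g) / 3") auto

lemma z_max_pos: "0 < z_fun \<epsilon> \<epsilon>g ((2 * \<epsilon> + \<epsilon>g) / 3)"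
  using z_strict_mono[of \<epsilon>g "(2 * \<epsilon> + \<epsilon>g) / 3"] z_at_g ge by simp

section \<open>Values of the continuations after each outcome of the DP step\<close>

lemma br_opt_mid:
  assumes "- \<epsilon> \<le> c" "c \<le> \<epsilon>"
  shows "br_opt \<epsilon> c = (q \<epsilon> ((c + \<epsilon>) / 2))\<^sup>2 * (1 - exp (- \<epsilon>))"
proof -
  have n: "1 - exp (- \<epsilon>) \<noteq> 0" using eps by simp
  have e: "(c + \<epsilon>) / 2 - \<epsilon> = (c - \<epsilon>) / 2" by (simp add: field_simps)
  have "(1 - exp ((c - \<epsilon>) / 2))\<^sup>2 / (1 - exp (- \<epsilon>)) = (q \<epsilon> ((c + \<epsilon>) / 2))\<^sup>2 * (1 - exp (- \<epsilon>))"
    unfolding q_def e using n by (simp add: power_divide power2_eq_square)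
  moreover have "br_opt \<epsilon> c = (1 - exp ((c - \<epsilon>) / 2))\<^sup>2 / (1 - exp (- \<epsilon>))"
  \<comment> \<open>At \<open>c = - \<epsilon>\<close> the first two formulas of
    \<open>br_opt\<close> agree.\<close>
  proof (cases "c = - \<epsilon>")
    case True
    then show ?thesis using n by (simp add: br_opt_def power2_eq_square)
  qed (use assms in \<open>simp add: br_opt_def\<close>)
  ultimately show ?thesis by simp
qed

lemma br_opt_high: "\<epsilon> \<le> c \<Longrightarrow> br_opt \<epsilon> c = 0"
  using eps by (auto simp: br_opt_def)

text \<open>After the DP outcome of log-ratio \<open>\<epsilon>\<close>, the upper BR outcome leaves
  \<open>\<epsilon>g - \<epsilon> - t\<close>, which drops to \<open>- \<epsilon>\<close> or below
  exactly when \<open>t \<ge> \<epsilon>g\<close>; this decides between y and x.\<close>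

lemma DP_up_branch:
  assumes "0 \<le> t" "t \<le> \<epsilon>"
  shows "q (2 * \<epsilon>) \<epsilon> * rr_mix t (\<epsilon> - t) (br_opt \<epsilon>) (\<epsilon>g - \<epsilon>) =
    (if \<epsilon>g \<le> t then y_fun \<epsilon> \<epsilon>g t else x_fun \<epsilon> \<epsilon>g t)"
proof -
  have 2: "br_opt \<epsilon> (\<epsilon>g - \<epsilon> + (\<epsilon> - t)) = (q \<epsilon> ((\<epsilon>g + \<epsilon> - t) / 2))\<^sup>2 * (1 - exp (- \<epsilon>))"
    using assms g0 ge by (subst br_opt_mid) (auto simp: algebra_simps)
  have 1: "br_opt \<epsilon> (\<epsilon>g - \<epsilon> - t) = (if \<epsilon>g \<le> t then 1 - exp (\<epsilon>g - \<epsilon> - t)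
      else (q \<epsilon> ((\<epsilon>g - t) / 2))\<^sup>2 * (1 - exp (- \<epsilon>)))"
  proof (cases "\<epsilon>g \<le> t")
    case False
    then show ?thesis using assms g0 ge by (subst br_opt_mid) auto
  qed (simp add: br_opt_def)
  show ?thesis unfolding rr_mix_def 1 2 by (simp add: x_fun_def y_fun_def)
qed

lemma DP_down_branch:
  assumes "0 \<le> t" "t \<le> \<epsilon>"
  shows "(1 - q (2 * \<epsilon>) \<epsilon>) * rr_mix t (\<epsilon> - t) (br_opt \<epsilon>) (\<epsilon>g + \<epsilon>) =
    (if \<epsilon>g \<le> t then z_fun \<epsilon> \<epsilon>g t else 0)"
proof -
  have 2: "br_opt \<epsilon> (\<epsilon>g + \<epsilon> + (\<epsilon> - t)) = 0"
    using assms g0 by (intro br_opt_high) auto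
  have e: "(\<epsilon>g + \<epsilon> - t + \<epsilon>) / 2 = \<epsilon> + (\<epsilon>g - t) / 2" by (simp add: field_simps)
  have 1: "br_opt \<epsilon> (\<epsilon>g + \<epsilon> - t) = (if \<epsilon>g \<le> t then (q \<epsilon> (\<epsilon> + (\<epsilon>g - t) / 2))\<^sup>2 * (1 - exp (- \<epsilon>)) else 0)"
  proof (cases "\<epsilon>g \<le> t")
    case True
    then have "br_opt \<epsilon> (\<epsilon>g + \<epsilon> - t) = (q \<epsilon> ((\<epsilon>g + \<epsilon> - t + \<epsilon>) / 2))\<^sup>2 * (1 - exp (- \<epsilon>))"
      using assms g0 by (intro br_opt_mid) auto
    then show ?thesis using True unfolding e by simp
  next
    case False
    then show ?thesis by (simp add: br_opt_high)
  qed
  show ?thesis unfolding rr_mix_def 1 2 by (simp add: z_fun_def)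
qed

text \<open>The maximizer on the upper branch: the peak of x if it lies in the region
  \<open>t \<le> \<epsilon>g\<close> where x applies, otherwise the peak of y, which then lies
  beyond \<open>\<epsilon>g\<close>.\<close>

definition up_arg where "up_arg = (if \<epsilon> / 2 \<le> \<epsilon>g then \<epsilon> / 2 else (\<epsilon> + \<epsilon>g) / 3)"

text \<open>The pieces x and y agree at \<open>\<epsilon>g\<close>, where z vanishes. If
  \<open>\<epsilon> / 2 \<le> \<epsilon>g\<close>, y only decreases beyond that point; otherwise x
  increases up to it and y takes over.\<close>

lemma DP_up_branch_max:
  assumes "0 \<le> t" "t \<le> \<epsilon>"
  shows "rr_mix t (\<epsilon> - t) (br_opt \<epsilon>) (\<epsilon>g - \<epsilon>) \<le> rr_mix up_arg (\<epsilon> - up_arg) (br_opt \<epsilon>) (\<epsilon>g - \<epsilon>)"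
proof -
  have xg: "x_fun \<epsilon> \<epsilon>g \<epsilon>g = y_fun \<epsilon> \<epsilon>g \<epsilon>g" by (simp add: x_eq_y_plus_z z_at_g)
  have up: "0 \<le> up_arg" "up_arg \<le> \<epsilon>" using eps g0 ge by (auto simp: up_arg_def)
  have q: "0 < q (2 * \<epsilon>) \<epsilon>" unfolding q_DP using E_bounds by (simp add: add_pos_pos)
  have "(if \<epsilon>g \<le> t then y_fun \<epsilon> \<epsilon>g t else x_fun \<epsilon> \<epsilon>g t)
      \<le> (if \<epsilon>g \<le> up_arg then y_fun \<epsilon> \<epsilon>g up_arg else x_fun \<epsilon> \<epsilon>g up_arg)"
  proof (cases "\<epsilon> / 2 \<le> \<epsilon>g")
    case True
    then have tu: "up_arg = \<epsilon> / 2" by (simp add: up_arg_def)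
    have "y_fun \<epsilon> \<epsilon>g t \<le> y_fun \<epsilon> \<epsilon>g \<epsilon>g" if "\<epsilon>g \<le> t"
      by (rule y_antimono) (use True that assms in auto)
    then have "(if \<epsilon>g \<le> t then y_fun \<epsilon> \<epsilon>g t else x_fun \<epsilon> \<epsilon>g t) \<le> x_fun \<epsilon> \<epsilon>g (\<epsilon> / 2)"
      using x_max[of t] x_max[of \<epsilon>g] xg by auto
    \<comment> \<open>If \<open>\<epsilon>g = \<epsilon> / 2\<close> the conditional selects y,
      which equals x there.\<close>
    also have "\<dots> = (if \<epsilon>g \<le> up_arg then y_fun \<epsilon> \<epsilon>g up_arg else x_fun \<epsilon> \<epsilon>g up_arg)"
      using True xg unfolding tu by (auto dest: antisym)
    finally show ?thesis .
  next
    case False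
    then have tu: "up_arg = (\<epsilon> + \<epsilon>g) / 3" "\<epsilon>g \<le> up_arg" by (simp_all add: up_arg_def)
    have "y_fun \<epsilon> \<epsilon>g t \<le> y_fun \<epsilon> \<epsilon>g up_arg" if "\<epsilon>g \<le> t"
      using y_mono[of t up_arg] y_antimono[of up_arg t] tu(1) assms by linarith
    moreover have "x_fun \<epsilon> \<epsilon>g t \<le> y_fun \<epsilon> \<epsilon>g up_arg" if "\<not> \<epsilon>g \<le> t"
    proof -
      have "x_fun \<epsilon> \<epsilon>g t \<le> x_fun \<epsilon> \<epsilon>g \<epsilon>g" using that False by (intro x_mono mult_nonneg_nonneg) auto
      also have "\<dots> \<le> y_fun \<epsilon> \<epsilon>g up_arg" unfolding xg by (rule y_mono) (use tu in auto)
      finally show ?thesis .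
    qed
    ultimately show ?thesis using tu(2) by auto
  qed
  then have "q (2 * \<epsilon>) \<epsilon> * rr_mix t (\<epsilon> - t) (br_opt \<epsilon>) (\<epsilon>g - \<epsilon>)
      \<le> q (2 * \<epsilon>) \<epsilon> * rr_mix up_arg (\<epsilon> - up_arg) (br_opt \<epsilon>) (\<epsilon>g - \<epsilon>)"
    unfolding DP_up_branch[OF assms] DP_up_branch[OF up] .
  then show ?thesis using q by simp
qed

lemma DP_down_branch_max:
  assumes "0 \<le> t" "t \<le> \<epsilon>" and s: "s = (2 * \<epsilon> + \<epsilon>g) / 3"
  shows "rr_mix t (\<epsilon> - t) (br_opt \<epsilon>) (\<epsilon>g + \<epsilon>) \<le> rr_mix s (\<epsilon> - s) (br_opt \<epsilon>) (\<epsilon>g + \<epsilon>)"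
proof -
  have sb: "0 \<le> s" "s \<le> \<epsilon>" "\<epsilon>g \<le> s" using eps g0 ge by (auto simp: s)
  have q: "0 < 1 - q (2 * \<epsilon>) \<epsilon>" unfolding q_DP using E_bounds by (simp add: add_pos_pos)
  have "(if \<epsilon>g \<le> t then z_fun \<epsilon> \<epsilon>g t else 0) \<le> (if \<epsilon>g \<le> s then z_fun \<epsilon> \<epsilon>g s else 0)"
    using z_max[of t] z_max_pos sb(3) unfolding s by auto
  then have "(1 - q (2 * \<epsilon>) \<epsilon>) * rr_mix t (\<epsilon> - t) (br_opt \<epsilon>) (\<epsilon>g + \<epsilon>)
      \<le> (1 - q (2 * \<epsilon>) \<epsilon>) * rr_mix s (\<epsilon> - s) (br_opt \<epsilon>) (\<epsilon>g + \<epsilon>)"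
    unfolding DP_down_branch[OF assms(1,2)] DP_down_branch[OF sb(1,2)] .
  then show ?thesis using q by simp
qed

text \<open>A BR step that comes first uses one \<open>t\<close> for both DP outcomes. The
  log-ratios add and the weights multiply, so exchanging the two steps leaves the value unchanged
  and it splits into the two DP branches at the same \<open>t\<close>.\<close>

lemma BR_first_value:
  assumes "0 \<le> t" "t \<le> \<epsilon>"
  shows "q (t + (\<epsilon> - t)) t * rr_mix \<epsilon> \<epsilon> (br_opt \<epsilon>) (\<epsilon>g - t)
     + (1 - q (t + (\<epsilon> - t)) t) * rr_mix \<epsilon> \<epsilon> (br_opt \<epsilon>) (\<epsilon>g + (\<epsilon> - t)) = x_fun \<epsilon> \<epsilon>g t"
proof -
  have e: "\<epsilon>g - t - \<epsilon> = \<epsilon>g - \<epsilon> - t" "\<epsilon>g - t + \<epsilon> = \<epsilon>g + \<epsilon> - t"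
    "\<epsilon>g + (\<epsilon> - t) - \<epsilon> = \<epsilon>g - \<epsilon> + (\<epsilon> - t)" "\<epsilon>g + (\<epsilon> - t) + \<epsilon> = \<epsilon>g + \<epsilon> + (\<epsilon> - t)" "\<epsilon> + \<epsilon> = 2 * \<epsilon>"
    by simp_all
  have "q (t + (\<epsilon> - t)) t * rr_mix \<epsilon> \<epsilon> (br_opt \<epsilon>) (\<epsilon>g - t)
     + (1 - q (t + (\<epsilon> - t)) t) * rr_mix \<epsilon> \<epsilon> (br_opt \<epsilon>) (\<epsilon>g + (\<epsilon> - t))
    = q (2 * \<epsilon>) \<epsilon> * rr_mix t (\<epsilon> - t) (br_opt \<epsilon>) (\<epsilon>g - \<epsilon>)
     + (1 - q (2 * \<epsilon>) \<epsilon>) * rr_mix t (\<epsilon> - t) (br_opt \<epsilon>) (\<epsilon>g + \<epsilon>)"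
    unfolding rr_mix_def e by (simp only: algebra_simps)
  also have "\<dots> = x_fun \<epsilon> \<epsilon>g t"
    unfolding DP_up_branch[OF assms] DP_down_branch[OF assms] by (simp add: x_eq_y_plus_z)
  finally show ?thesis .
qed

end

section \<open>Evaluation and comparison of the two orders of composition\<close>

theorem lemma5p4:
  fixes nb :: "'x \<Rightarrow> 'x \<Rightarrow> bool" and \<epsilon> \<epsilon>g :: real
  assumes "symp nb" and "\<exists>x x'. x \<noteq> x' \<and> nb x x'"
    and "two_elements TYPE('a)" and "two_elements TYPE('b)" and "two_elements TYPE('c)"
    and "0 < \<epsilon>" and "0 \<le> \<epsilon>g" and "\<epsilon>g < \<epsilon>"
  shows
    "delta_opt_class nb
       (DP_class nb \<epsilon> \<triangleright> BR_class nb \<epsilon> \<triangleright> BR_class nb \<epsilon> :: ('x, ('a \<times> 'b) \<times> 'c) mechanism set) \<epsilon>g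
     > delta_opt_class nb
       (BR_class nb \<epsilon> \<triangleright> DP_class nb \<epsilon> \<triangleright> BR_class nb \<epsilon> :: ('x, ('a \<times> 'b) \<times> 'c) mechanism set) \<epsilon>g
     \<and> delta_opt_class nb
       (DP_class nb \<epsilon> \<triangleright> BR_class nb \<epsilon> \<triangleright> BR_class nb \<epsilon> :: ('x, ('a \<times> 'b) \<times> 'c) mechanism set) \<epsilon>g
       = (if \<epsilon>g \<ge> \<epsilon> / 2
          then x_fun \<epsilon> \<epsilon>g (\<epsilon> / 2) + z_fun \<epsilon> \<epsilon>g ((2 * \<epsilon> + \<epsilon>g) / 3)
          else y_fun \<epsilon> \<epsilon>g ((\<epsilon> + \<epsilon>g) / 3) + z_fun \<epsilon> \<epsilon>g ((2 * \<epsilon> + \<epsilon>g) / 3))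
     \<and> delta_opt_class nb
       (BR_class nb \<epsilon> \<triangleright> DP_class nb \<epsilon> \<triangleright> BR_class nb \<epsilon> :: ('x, ('a \<times> 'b) \<times> 'c) mechanism set) \<epsilon>g
       = (if \<epsilon>g \<ge> \<epsilon> / 2
          then max (x_fun \<epsilon> \<epsilon>g (\<epsilon> / 2)) (y_fun \<epsilon> \<epsilon>g \<epsilon>g + z_fun \<epsilon> \<epsilon>g \<epsilon>g)
          else max (x_fun \<epsilon> \<epsilon>g \<epsilon>g) (y_fun \<epsilon> \<epsilon>g (\<epsilon> / 2) + z_fun \<epsilon> \<epsilon>g (\<epsilon> / 2)))"
proof -
  interpret composition_params \<epsilon> \<epsilon>g by unfold_locales fact+
  obtain x x' :: 'x where x: "x \<noteq> x'" "nb x x'" using assms(2) by blast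
  let ?tz = "(2 * \<epsilon> + \<epsilon>g) / 3"
  let ?V1 = "if \<epsilon>g \<ge> \<epsilon> / 2
          then x_fun \<epsilon> \<epsilon>g (\<epsilon> / 2) + z_fun \<epsilon> \<epsilon>g ((2 * \<epsilon> + \<epsilon>g) / 3)
          else y_fun \<epsilon> \<epsilon>g ((\<epsilon> + \<epsilon>g) / 3) + z_fun \<epsilon> \<epsilon>g ((2 * \<epsilon> + \<epsilon>g) / 3)"
  let ?V2 = "if \<epsilon>g \<ge> \<epsilon> / 2
          then max (x_fun \<epsilon> \<epsilon>g (\<epsilon> / 2)) (y_fun \<epsilon> \<epsilon>g \<epsilon>g + z_fun \<epsilon> \<epsilon>g \<epsilon>g)
          else max (x_fun \<epsilon> \<epsilon>g \<epsilon>g) (y_fun \<epsilon> \<epsilon>g (\<epsilon> / 2) + z_fun \<epsilon> \<epsilon>g (\<epsilon> / 2))"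
  \<comment> \<open>The dummy variable generalizes the facts over the outcome type
    \<open>'z\<close>, so that they serve both the first and the second step.\<close>
  have rich_DP: "rr_rich nb {(\<epsilon>, \<epsilon>)} (DP_class nb \<epsilon> :: ('x, 'z) mechanism set)"
    and rich_BR: "rr_rich nb (br_params \<epsilon>) (BR_class nb \<epsilon> :: ('x, 'z) mechanism set)" for dummy :: 'z
    using rr_in_DP_class[OF eps] rr_in_BR_class[OF eps] by (auto simp: rr_rich_def br_params_def)
  note classes = likelihood_class_DP[OF eps assms(1)] rich_DP likelihood_class_BR[OF eps] rich_BR
  have up: "0 \<le> up_arg" "up_arg \<le> \<epsilon>" using eps g0 ge by (auto simp: up_arg_def)
  have tz: "0 \<le> ?tz" "?tz \<le> \<epsilon>" "\<epsilon>g \<le> ?tz" using eps g0 ge by auto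
  have V1: "?V1 = q (\<epsilon> + \<epsilon>) \<epsilon> * rr_mix up_arg (\<epsilon> - up_arg) (br_opt \<epsilon>) (\<epsilon>g - \<epsilon>)
      + (1 - q (\<epsilon> + \<epsilon>) \<epsilon>) * rr_mix ?tz (\<epsilon> - ?tz) (br_opt \<epsilon>) (\<epsilon>g + \<epsilon>)"
  proof -
    have "(if \<epsilon>g \<le> up_arg then y_fun \<epsilon> \<epsilon>g up_arg else x_fun \<epsilon> \<epsilon>g up_arg) + z_fun \<epsilon> \<epsilon>g ?tz = ?V1"
    \<comment> \<open>At equality the branch formula gives y while the claim has x; they coincide
      because z vanishes at \<open>\<epsilon>g\<close>.\<close>
    proof (cases "\<epsilon>g = \<epsilon> / 2")
      case True
      then have half: "\<epsilon> / 2 = \<epsilon>g" and arg: "up_arg = \<epsilon>g" by (simp_all add: up_arg_def)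
      show ?thesis unfolding arg half using x_eq_y_plus_z[of \<epsilon>g] z_at_g by simp
    qed (auto simp: up_arg_def)
    then show ?thesis
      using DP_up_branch[OF up] DP_down_branch[OF tz(1,2)] tz(3) by (simp flip: mult_2)
  qed
  \<comment> \<open>By x = y + z, both cases are the maximum of x at \<open>\<epsilon>g\<close> and
    at \<open>\<epsilon> / 2\<close>.\<close>
  have V2: "?V2 = x_fun \<epsilon> \<epsilon>g (\<epsilon> / 2)"
    using x_max[of \<epsilon>g] by (simp add: max_def flip: x_eq_y_plus_z)
  have 1: "delta_opt_class nb
       (DP_class nb \<epsilon> \<triangleright> BR_class nb \<epsilon> \<triangleright> BR_class nb \<epsilon> :: ('x, ('a \<times> 'b) \<times> 'c) mechanism set) \<epsilon>g = ?V1"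
  \<comment> \<open>The BR step sees the DP outcome, so each branch gets its own maximizer.\<close>
  proof (rule delta_opt_class_comp_eq[OF assms(3-5) eps x classes,
        where a = \<epsilon> and b = \<epsilon> and a' = "\<lambda>z. if z then up_arg else ?tz"
          and b' = "\<lambda>z. \<epsilon> - (if z then up_arg else ?tz)"])
    show "(if z then up_arg else ?tz, \<epsilon> - (if z then up_arg else ?tz)) \<in> br_params \<epsilon>" for z
      using up tz by (auto simp: br_params_def)
  next
    fix a b assume "(a, b) \<in> {(\<epsilon>, \<epsilon>)}"
    then have ab: "a = \<epsilon>" "b = \<epsilon>" by simp_all
    show "\<exists>Ka Kb. (\<forall>a' b'. (a', b') \<in> br_params \<epsilon> \<longrightarrow>
        rr_mix a' b' (br_opt \<epsilon>) (\<epsilon>g - a) \<le> Ka \<and> rr_mix a' b' (br_opt \<epsilon>) (\<epsilon>g + b) \<le> Kb) \<and>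
        q (a + b) a * Ka + (1 - q (a + b) a) * Kb \<le> ?V1"
      unfolding V1 ab
      by (intro exI[of _ "rr_mix up_arg (\<epsilon> - up_arg) (br_opt \<epsilon>) (\<epsilon>g - \<epsilon>)"]
          exI[of _ "rr_mix ?tz (\<epsilon> - ?tz) (br_opt \<epsilon>) (\<epsilon>g + \<epsilon>)"] conjI allI impI order_refl)
         (auto simp: br_params_def intro!: DP_up_branch_max DP_down_branch_max)
  next
    show "?V1 = q (\<epsilon> + \<epsilon>) \<epsilon> * rr_mix (if True then up_arg else ?tz)
          (\<epsilon> - (if True then up_arg else ?tz)) (br_opt \<epsilon>) (\<epsilon>g - \<epsilon>)
        + (1 - q (\<epsilon> + \<epsilon>) \<epsilon>) * rr_mix (if False then up_arg else ?tz)
          (\<epsilon> - (if False then up_arg else ?tz)) (br_opt \<epsilon>) (\<epsilon>g + \<epsilon>)"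
      unfolding V1 if_True if_False ..
  qed simp
  have 2: "delta_opt_class nb
       (BR_class nb \<epsilon> \<triangleright> DP_class nb \<epsilon> \<triangleright> BR_class nb \<epsilon> :: ('x, ('a \<times> 'b) \<times> 'c) mechanism set) \<epsilon>g = ?V2"
  proof (rule delta_opt_class_comp_eq[OF assms(3-5) eps x classes(3,4,1,2),
        where a = "\<epsilon> / 2" and b = "\<epsilon> - \<epsilon> / 2" and a' = "\<lambda>z. \<epsilon>" and b' = "\<lambda>z. \<epsilon>"])
    show "(\<epsilon> / 2, \<epsilon> - \<epsilon> / 2) \<in> br_params \<epsilon>"
      unfolding br_params_def by (intro CollectI exI[of _ "\<epsilon> / 2"]) (use eps in simp)
    show "(\<epsilon>, \<epsilon>) \<in> {(\<epsilon>, \<epsilon>)}" by simp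
    show "?V2 = q (\<epsilon> / 2 + (\<epsilon> - \<epsilon> / 2)) (\<epsilon> / 2) * rr_mix \<epsilon> \<epsilon> (br_opt \<epsilon>) (\<epsilon>g - \<epsilon> / 2)
        + (1 - q (\<epsilon> / 2 + (\<epsilon> - \<epsilon> / 2)) (\<epsilon> / 2)) * rr_mix \<epsilon> \<epsilon> (br_opt \<epsilon>) (\<epsilon>g + (\<epsilon> - \<epsilon> / 2))"
      unfolding V2 by (rule BR_first_value[symmetric]) (use eps in auto)
  next
    fix a b assume "(a, b) \<in> br_params \<epsilon>"
    then obtain t where t: "a = t" "b = \<epsilon> - t" "0 \<le> t" "t \<le> \<epsilon>" by (auto simp: br_params_def)
    show "\<exists>Ka Kb. (\<forall>a' b'. (a', b') \<in> {(\<epsilon>, \<epsilon>)} \<longrightarrow>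
        rr_mix a' b' (br_opt \<epsilon>) (\<epsilon>g - a) \<le> Ka \<and> rr_mix a' b' (br_opt \<epsilon>) (\<epsilon>g + b) \<le> Kb) \<and>
        q (a + b) a * Ka + (1 - q (a + b) a) * Kb \<le> ?V2"
      \<comment> \<open>The DP step has no parameter to choose, so \<open>Ka\<close> and
        \<open>Kb\<close> are exact values and their mixture is x at \<open>t\<close>.\<close>
      unfolding V2 t
      by (intro exI[of _ "rr_mix \<epsilon> \<epsilon> (br_opt \<epsilon>) (\<epsilon>g - t)"]
          exI[of _ "rr_mix \<epsilon> \<epsilon> (br_opt \<epsilon>) (\<epsilon>g + (\<epsilon> - t))"] conjI allI impI)
         (auto simp only: BR_first_value[OF t(3,4)] x_max singleton_iff prod.inject)
  qed
  have less: "?V2 < ?V1"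
  proof (cases "\<epsilon>g \<ge> \<epsilon> / 2")
    case True
    then show ?thesis unfolding V2 using z_max_pos by simp
  next
    case False
    \<comment> \<open>Here \<open>\<epsilon> / 2\<close> lies past the peak of y and strictly before
      the peak of z, so the shared parameter loses strictly on the z branch.\<close>
    have "y_fun \<epsilon> \<epsilon>g (\<epsilon> / 2) \<le> y_fun \<epsilon> \<epsilon>g ((\<epsilon> + \<epsilon>g) / 3)"
      by (rule y_antimono) (use False eps in auto)
    moreover have "z_fun \<epsilon> \<epsilon>g (\<epsilon> / 2) < z_fun \<epsilon> \<epsilon>g ?tz"
      by (rule z_strict_mono) (use False eps g0 in auto)
    ultimately show ?thesis unfolding V2 unfolding x_eq_y_plus_z using False by simp
  qed
  show ?thesis unfolding 1 2 by (intro conjI refl less)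
qed

end
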